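(* Let $n\ge 3$ be an odd integer with $7\mid n$, and let $k$ be an integer with $1\le k\le n-1$ and $(n,k)\ne(49,23),(49,26)$. Then the multiplicative inverse function $f_{\mathrm{inv}}$ on $\mathbb F_{2^n}$ is $k$th order sum-free if and only if $k\in\{1,2,n-2,n-1\}$.
   Context: The multiplicative inverse function $f_{\mathrm{inv}}:\mathbb F_{2^n}\to\mathbb F_{2^n}$ is defined by $f_{\mathrm{inv}}(x)=x^{-1}$ for $x\ne 0$ and $f_{\mathrm{inv}}(0)=0$. A function $f:\mathbb F_{2^n}\to\mathbb F_{2^n}$ is $k$th order sum-free if $\sum_{x\in A}f(x)\ne 0$ for every $k$-dimensional $\mathbb F_2$-affine subspace $A$ of $\mathbb F_{2^n}$. *)

theory Defs
  imports Complex_Main "HOL-Computational_Algebra.Primes" "HOL-Library.Cardinality" "HOL-Library.Z2"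
begin

text \<open>
  \<^typ>\<open>bit\<close> is the prime field $F_2$. The action below makes a field of characteristic 2 a vector
  space over it (see \<open>vector_space_F2_scale\<close>); in any other characteristic it is not a vector space
  structure, and the notions built on it are meaningless there.
\<close>

definition F2_scale :: "bit \<Rightarrow> 'a::field \<Rightarrow> 'a" where
  "F2_scale c x = of_bool (c = 1) * x"

definition F2_affine_subspace :: "nat \<Rightarrow> 'a::field set \<Rightarrow> bool" where
  "F2_affine_subspace k A \<longleftrightarrow>
     (\<exists>a V. module.subspace F2_scale V \<and> vector_space.dim F2_scale V = k \<and> A = (\<lambda>v. a + v) ` V)"

definition sum_free :: "nat \<Rightarrow> ('a::finite_field \<Rightarrow> 'a) \<Rightarrow> bool" where
  "sum_free k f \<longleftrightarrow> (\<forall>A. F2_affine_subspace k A \<longrightarrow> (\<Sum>x\<in>A. f x) \<noteq> 0)"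

definition f_inv :: "'a::field \<Rightarrow> 'a" where
  "f_inv x = (if x = 0 then 0 else inverse x)"

lemma vector_space_F2_scale:
  assumes "CHAR('a::field) = 2"
  shows "vector_space (F2_scale :: bit \<Rightarrow> 'a \<Rightarrow> 'a)"
proof -
  have "(2::'a) = 0"
    using of_nat_CHAR[where ?'a = 'a] assms by simp
  then have double: "x + x = 0" for x :: 'a
    by (metis mult_2 mult_zero_left)
  show ?thesis
  proof
    fix a b :: bit and x y :: 'a
    show "F2_scale a (x + y) = F2_scale a x + F2_scale a y"
      by (simp add: F2_scale_def algebra_simps)
    show "F2_scale (a + b) x = F2_scale a x + F2_scale b x"
      by (cases a; cases b) (simp_all add: F2_scale_def double)
    show "F2_scale a (F2_scale b x) = F2_scale (a * b) x"
      by (cases a; cases b) (simp_all add: F2_scale_def)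
    show "F2_scale 1 x = x"
      by (simp add: F2_scale_def)
  qed
qed

lemma CHAR_eq_2_of_CARD:
  assumes "CARD('a::finite_field) = 2 ^ n"
  shows "CHAR('a) = 2"
proof -
  have "(\<Sum>x\<in>UNIV. x) = (\<Sum>x\<in>UNIV. x + 1 :: 'a)"
    by (rule sum.reindex_bij_witness[of _ "\<lambda>x. x + 1" "\<lambda>x. x - 1"]) auto
  then have "of_nat CARD('a) = (0 :: 'a)"
    by (simp add: sum.distrib)
  then have "CHAR('a) dvd 2 ^ n"
    using assms of_nat_eq_0_iff_char_dvd by metis
  moreover have "prime CHAR('a)"
    by (rule prime_CHAR_semidom) simp
  ultimately show ?thesis
    by (metis prime_dvd_power primes_dvd_imp_eq two_is_prime_nat)
qed

end

theory Submission
  imports Defs "HOL-Computational_Algebra.Polynomial"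
begin

text \<open>
  Write \<open>S(V)\<close> for the sum of the inverses of the nonzero elements of an additive subgroup \<open>V\<close>, \<open>w(V)\<close> for their product, and
  \<open>L\<^sub>V(x)\<close> for the product of all \<open>x + v\<close> with \<open>v\<close> in \<open>V\<close>, which is an additive function of \<open>x\<close> with kernel
  \<open>V\<close>. The sum of the inverses over a coset \<open>a + V\<close> that misses \<open>0\<close> is \<open>w(V) / L\<^sub>V(a)\<close>
  (\<open>coset_inv_sum\<close>), so it never vanishes, and sum-freedom only depends on the values \<open>S(V)\<close>
  (\<open>sum_free_f_inv_iff\<close>).

  Grouping a larger space into cosets of \<open>U\<close> gives the tool on which everything rests
  (\<open>preimage_inv_sum\<close>): if \<open>V\<close> is the preimage of \<open>T\<close> under \<open>L\<^sub>U\<close>, then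
  \<open>S(V) = S(U) + w(U) * S(T)\<close>. With \<open>V\<close> the whole field, where \<open>S\<close> vanishes, this is a duality
  (\<open>inv_sum_dual\<close>): \<open>S(U) = 0\<close> if and only if \<open>S(T) = 0\<close> for the image \<open>T\<close> of \<open>L\<^sub>U\<close>, a space of complementary dimension.
  Dimensions 1 and 2 are sum-free by direct computation: in dimension 2 a space with \<open>S(V) = 0\<close> would yield a primitive cube
  root of unity, and there is none as \<open>n\<close> is odd. Duality adds the dimensions \<open>n - 1\<close> and
  \<open>n - 2\<close>.

  For the other dimensions a space with \<open>S(V) = 0\<close> has to be found. Let \<open>n = 7 * m\<close>, \<open>Q = 2^m\<close> and let \<open>\<phi>\<close> be
  the \<open>Q\<close>-power map, of order 7. Since \<open>X^7 + 1 = (X + 1) (X^3 + X^2 + 1) (X^3 + X + 1)\<close> over the prime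
  field, the field is the direct sum of the kernels \<open>K\<^sub>0\<close> (the subfield with \<open>Q\<close> elements), \<open>K\<^sub>1\<close> and
  \<open>K\<^sub>2\<close> of the three factors evaluated at \<open>\<phi>\<close>. If \<open>U\<close> is stable under \<open>\<phi>\<close>, then \<open>S(U)\<close> and \<open>w(U)\<close> are
  fixed by \<open>\<phi>\<close>, so they lie in \<open>K\<^sub>0\<close>, and \<open>L\<^sub>U\<close> maps each \<open>K\<^sub>i\<close> that meets \<open>U\<close> only in \<open>0\<close> bijectively onto itself.
  Scaling a space \<open>T\<close> by \<open>c\<close> divides \<open>S(T)\<close> by \<open>c\<close>; hence every nonzero element of \<open>K\<^sub>0\<close> is \<open>S(T)\<close> for
  some \<open>d\<close>-dimensional \<open>T\<close> inside \<open>K\<^sub>0\<close>, where \<open>1 \<le> d < m\<close>. Choosing \<open>S(T) = S(U) / w(U)\<close> makes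
  the inverse sum of the preimage of \<open>T\<close> under \<open>L\<^sub>U\<close> vanish (\<open>zero_inv_sum_mixed\<close>). It remains to provide stable
  \<open>U\<close> with \<open>S(U)\<close> nonzero. In \<open>K\<^sub>2\<close> there are stable spaces of
  each dimension \<open>3 * i\<close> with \<open>i \<le> m\<close>, and adjoining to one of them a suitable multiple of a stable 3-dimensional
  subspace \<open>l\<close> of \<open>K\<^sub>1\<close> with \<open>S(l)\<close> nonzero makes the inverse sum nonzero (\<open>stable_space_nonzero_inv_sum\<close>);
  such an \<open>l\<close> exists because \<open>S(l) = 0\<close> is a polynomial condition of
  degree less than \<open>Q^3\<close>, the order of \<open>K\<^sub>1\<close> (\<open>line_nonzero_inv_sum\<close>).

  This realises the dimensions \<open>d + 3 * (i + 1)\<close> with \<open>1 \<le> d < m\<close> and \<open>i \<le> m\<close>. For \<open>m \<ge> 5\<close> they include all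
  dimensions between 4 and \<open>n / 2\<close>, and duality reflects these to the upper half. Dimension 3 is
  realised inside the subfield with 128 elements by the kernel of \<open>x^8 + x^4 + x\<close>, and for \<open>n = 21\<close> the dimensions
  6 and 9 are realised by spaces closed under multiplication by the subfield with 8 elements.
\<close>

section \<open>Additive subgroups and their inverse sums\<close>

text \<open>
  Additive subgroups, described without reference to scalars; in characteristic 2 closure under addition suffices,
  and these are the subspaces over the prime field.
\<close>

definition F2_space :: "'a::field set \<Rightarrow> bool" where
  "F2_space V \<longleftrightarrow> 0 \<in> V \<and> (\<forall>x\<in>V. \<forall>y\<in>V. x + y \<in> V)"

definition vanishing :: "'a::field set \<Rightarrow> 'a \<Rightarrow> 'a" where
  "vanishing V x = (\<Prod>v\<in>V. x + v)"

definition nonzero_prod :: "'a::field set \<Rightarrow> 'a" where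
  "nonzero_prod V = \<Prod>(V - {0})"

definition inv_sum :: "'a::field set \<Rightarrow> 'a" where
  "inv_sum V = (\<Sum>v\<in>V. inverse v)"

definition frob :: "nat \<Rightarrow> 'a::field \<Rightarrow> 'a" where
  "frob j x = x ^ (2 ^ j)"

text \<open>
  The span of three vectors is listed explicitly, so that membership and stability can be checked element by element.
\<close>

definition span3 :: "'a::field \<Rightarrow> 'a \<Rightarrow> 'a \<Rightarrow> 'a set" where
  "span3 a b c = {0, a, b, a + b, c, a + c, b + c, a + b + c}"

text \<open>
  The numerator of the inverse sum of \<open>span3 a b c\<close>; it is the sum of all products of six of the seven
  nonzero elements, a Dickson invariant of three variables.
\<close>

definition span3_numerator :: "'a::field \<Rightarrow> 'a \<Rightarrow> 'a \<Rightarrow> 'a" where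
  "span3_numerator a b c =
     (a^2 + a*b + b^2) * (c^4 + (a^2 + a*b + b^2) * c^2 + a*b*(a + b) * c) + (a*b*(a + b))^2"

lemma F2_spaceD: "F2_space V \<Longrightarrow> 0 \<in> V" "F2_space V \<Longrightarrow> x \<in> V \<Longrightarrow> y \<in> V \<Longrightarrow> x + y \<in> V"
  by (auto simp: F2_space_def)

lemma F2_space_sum: "F2_space V \<Longrightarrow> (\<And>i. i \<in> I \<Longrightarrow> g i \<in> V) \<Longrightarrow> sum g I \<in> V"
  by (induction I rule: infinite_finite_induct) (auto simp: F2_space_def)

locale binary_field =
  fixes ty :: "'a::finite_field itself"
  assumes char_two: "CHAR('a) = 2"
begin

lemma two_eq_0: "(2::'a) = 0"
  using of_nat_CHAR[where ?'a = 'a] char_two by simp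

lemma add_self: "x + x = (0::'a)"
  by (metis mult_2 mult_zero_left two_eq_0)

lemma add_self_left: "x + (x + y) = (y::'a)"
  by (simp add: add.assoc[symmetric] add_self)

lemma minus_eq: "- x = (x::'a)"
  by (metis add_self minus_unique)

lemma diff_eq: "x - y = (x + y::'a)"
  by (metis diff_conv_add_uminus minus_eq)

lemma add_eq_0: "x + y = (0::'a) \<longleftrightarrow> x = y"
  by (metis add_self add_self_left add.right_neutral)

text \<open>
  A complete rewrite system for polynomial identities in characteristic 2: after full expansion and sorting, equal
  monomials cancel in pairs.
\<close>

lemmas ring_char2 = distrib_left distrib_right ac_simps add_self add_self_left add_0_left add_0_right

lemma F2_space_add_iff: "F2_space V \<Longrightarrow> x \<in> V \<Longrightarrow> x + y \<in> V \<longleftrightarrow> (y::'a) \<in> V"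
  by (metis F2_spaceD(2) add_self_left)

lemma coset_disjoint:
  assumes "F2_space V" "(b::'a) \<notin> V"
  shows "V \<inter> (+) b ` V = {}"
proof -
  have "b + v \<notin> V" if "v \<in> V" for v
    using F2_space_add_iff[OF assms(1) that, of b] assms(2) by (simp add: add.commute)
  then show ?thesis by auto
qed

lemma prod_double:
  assumes "F2_space V" "(b::'a) \<notin> V"
  shows "(\<Prod>v\<in>V \<union> (+) b ` V. g v) = (\<Prod>v\<in>V. g v) * (\<Prod>v\<in>V. g (b + v))"
  using coset_disjoint[OF assms] by (subst prod.union_disjoint) (auto simp: prod.reindex)

lemma F2_space_double:
  assumes "F2_space V"
  shows "F2_space (V \<union> (+) (b::'a) ` V)"
proof -
  have *: "x + y \<in> V \<union> (+) b ` V" if "x \<in> V" "y \<in> V \<union> (+) b ` V" for x y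
  proof -
    have "x + (b + v) = b + (x + v)" for v by (simp add: add.left_commute)
    then show ?thesis using that F2_spaceD(2)[OF assms] by auto
  qed
  have **: "(b + x) + y \<in> V \<union> (+) b ` V" if "x \<in> V" "y \<in> V \<union> (+) b ` V" for x y
  proof -
    have "b + x + (b + v) = x + v" for v
      by (metis add.assoc add.commute add_self_left)
    then show ?thesis using that F2_spaceD(2)[OF assms] by (auto simp: add.assoc)
  qed
  show ?thesis
    unfolding F2_space_def using * ** F2_spaceD(1)[OF assms] by blast
qed

lemma vanishing_double:
  assumes "F2_space V" "(b::'a) \<notin> V"
  shows "vanishing (V \<union> (+) b ` V) x = vanishing V x * vanishing V (x + b)"
  by (simp only: vanishing_def prod_double[OF assms] add.assoc)

text \<open>
  Every additive subgroup arises from \<open>0\<close> by repeatedly adjoining a vector, each time doubling its size. This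
  is the induction behind the additivity of \<open>vanishing V\<close> and the formula for coset sums.
\<close>

lemma F2_space_induct [consumes 1, case_names zero double]:
  assumes "F2_space (V::'a set)"
    and "P {0}"
    and "\<And>V b. F2_space V \<Longrightarrow> b \<notin> V \<Longrightarrow> P V \<Longrightarrow> P (V \<union> (+) b ` V)"
  shows "P V"
proof -
  have "\<exists>W\<subseteq>V. F2_space W \<and> P W \<and> B \<subseteq> W" if "B \<subseteq> V" for B
    using finite[of B] that
  proof (induction B)
    case empty
    then show ?case using assms(1,2) by (intro exI[of _ "{0}"]) (auto simp: F2_space_def)
  next
    case (insert b B)
    then obtain W where W: "W \<subseteq> V" "F2_space W" "P W" "B \<subseteq> W" by blast
    show ?case
    proof (cases "b \<in> W")
      case True
      then show ?thesis using W by auto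
    next
      case False
      have "b \<in> (+) b ` W" using imageI[OF F2_spaceD(1)[OF W(2)], of "(+) b"] by simp
      moreover have "(+) b ` W \<subseteq> V" using insert.prems W(1) F2_spaceD(2)[OF assms(1)] by blast
      ultimately show ?thesis
        using W assms(3)[OF W(2) False W(3)] F2_space_double[OF W(2), of b]
        by (intro exI[of _ "W \<union> (+) b ` W"]) blast
    qed
  qed
  from this[OF subset_refl] obtain W where "W \<subseteq> V" "P W" "V \<subseteq> W" by blast
  then show ?thesis by (simp add: subset_antisym)
qed

lemma vanishing_eq_0_iff: "vanishing V x = 0 \<longleftrightarrow> (x::'a) \<in> V"
  by (auto simp: vanishing_def add_eq_0)

text \<open>
  For a doubled space, \<open>vanishing\<close> is \<open>L x * (L x + L b)\<close>, where \<open>L\<close> belongs to the smaller space;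
  additivity of \<open>L\<close> passes to this expression as squaring is additive.
\<close>

lemma vanishing_add:
  assumes "F2_space (V::'a set)"
  shows "vanishing V (x + y) = vanishing V x + vanishing V y"
  using assms
proof (induction V arbitrary: x y rule: F2_space_induct)
  case zero
  then show ?case by (simp add: vanishing_def)
next
  case (double V b)
  have v: "vanishing (V \<union> (+) b ` V) z = vanishing V z * (vanishing V z + vanishing V b)" for z
    using vanishing_double[OF double.hyps, of z] double.IH[of z b] by simp
  show ?case
    by (simp only: v double.IH) (simp only: ring_char2)
qed

lemma nonzero_prod_double:
  assumes "F2_space V" "(b::'a) \<notin> V"
  shows "nonzero_prod (V \<union> (+) b ` V) = nonzero_prod V * vanishing V b"
proof -
  have "V \<union> (+) b ` V - {0} = (V - {0}) \<union> (+) b ` V"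
    using coset_disjoint[OF assms] F2_spaceD(1)[OF assms(1)] by auto
  moreover have "(V - {0}) \<inter> (+) b ` V = {}"
    using coset_disjoint[OF assms] by auto
  ultimately show ?thesis
    by (simp add: nonzero_prod_def vanishing_def prod.union_disjoint prod.reindex)
qed

lemma nonzero_prod_nonzero: "nonzero_prod (V::'a set) \<noteq> 0"
  by (auto simp: nonzero_prod_def)

text \<open>
  This is the partial fraction expansion of the reciprocal of the separable additive polynomial with root set
  \<open>V\<close>, whose derivative is the constant \<open>nonzero_prod V\<close>.
\<close>

lemma coset_inv_sum:
  assumes "F2_space (V::'a set)" "a \<notin> V"
  shows "(\<Sum>v\<in>V. inverse (a + v)) = nonzero_prod V / vanishing V a"
  using assms
proof (induction V arbitrary: a rule: F2_space_induct)
  case zero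
  then show ?case by (simp add: nonzero_prod_def vanishing_def divide_inverse)
next
  case (double V b)
  have "b + (a + b) = a"
    by (simp only: ring_char2)
  then have "a \<in> (+) b ` V" if "a + b \<in> V"
    using imageI[OF that, of "(+) b"] by (simp only: \<open>b + (a + b) = a\<close>)
  then have a: "a \<notin> V" "a + b \<notin> V"
    using double.prems by blast+
  have nz: "vanishing V a \<noteq> 0" "vanishing V (a + b) \<noteq> 0"
    using a by (auto simp: vanishing_eq_0_iff)
  have "(\<Sum>v\<in>V \<union> (+) b ` V. inverse (a + v))
      = (\<Sum>v\<in>V. inverse (a + v)) + (\<Sum>v\<in>V. inverse ((a + b) + v))"
    using coset_disjoint[OF double.hyps] by (subst sum.union_disjoint) (auto simp: sum.reindex add.assoc)
  also have "\<dots> = nonzero_prod V / vanishing V a + nonzero_prod V / vanishing V (a + b)"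
    using double.IH a by simp
  also have "\<dots> = nonzero_prod V * (vanishing V (a + b) + vanishing V a) / (vanishing V a * vanishing V (a + b))"
    using nz by (simp add: field_simps)
  also have "vanishing V (a + b) + vanishing V a = vanishing V b"
    using vanishing_add[OF double.hyps(1)] by (simp add: add.commute add_self_left)
  finally show ?case
    using double.hyps by (simp add: nonzero_prod_double vanishing_double)
qed

lemma inv_sum_double:
  assumes "F2_space V" "(b::'a) \<notin> V"
  shows "inv_sum (V \<union> (+) b ` V) = inv_sum V + nonzero_prod V / vanishing V b"
  unfolding inv_sum_def using coset_disjoint[OF assms] coset_inv_sum[OF assms]
  by (subst sum.union_disjoint) (auto simp: sum.reindex)

lemma fiber_eq_coset:
  assumes "F2_space M" "\<And>x y. h (x + y) = h x + (h y::'a)" "(a::'a) \<in> M"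
  shows "{x \<in> M. h x = h a} = (+) a ` {x \<in> M. h x = 0}"
proof (intro equalityI subsetI)
  fix x assume "x \<in> {x \<in> M. h x = h a}"
  then have "a + x \<in> {x \<in> M. h x = 0}" "x = a + (a + x)"
    using assms by (auto simp: add_self add_self_left F2_spaceD)
  then show "x \<in> (+) a ` {x \<in> M. h x = 0}" by blast
qed (use assms in \<open>auto simp: F2_spaceD\<close>)

lemma preimage_F2_space:
  assumes "F2_space M" "\<And>x y. h (x + y) = h x + (h y::'a)" "F2_space T" "T \<subseteq> h ` M"
  defines "V \<equiv> {x \<in> M. h (x::'a) \<in> T}"
  shows "F2_space V" "h ` V = T" "card V = card {x \<in> M. h x = 0} * card T"
proof -
  have h0: "h 0 = 0" using assms(2)[of 0 0] by (simp add: add_self)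
  show "F2_space V" using assms h0 by (auto simp: F2_space_def V_def)
  show im: "h ` V = T" using assms(4) by (auto simp: V_def)
  have "card V = (\<Sum>x\<in>V. 1)" by simp
  also have "\<dots> = (\<Sum>t\<in>h ` V. \<Sum>x\<in>{x \<in> V. h x = t}. 1)"
    by (rule sum.image_gen) simp
  also have "\<dots> = (\<Sum>t\<in>h ` V. card {x \<in> M. h x = 0})"
  proof (rule sum.cong)
    fix t assume "t \<in> h ` V"
    then obtain a where a: "a \<in> M" "h a \<in> T" "t = h a" by (auto simp: V_def)
    then have "{x \<in> V. h x = t} = {x \<in> M. h x = h a}" by (auto simp: V_def)
    also have "\<dots> = (+) a ` {x \<in> M. h x = 0}" using fiber_eq_coset[OF assms(1,2) a(1)] .
    finally show "(\<Sum>x\<in>{x \<in> V. h x = t}. 1) = card {x \<in> M. h x = 0}"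
      by (simp add: card_image)
  qed simp
  finally show "card V = card {x \<in> M. h x = 0} * card T" using im by simp
qed

lemma image_F2_space:
  assumes "F2_space M" "\<And>x y. h (x + y) = h x + (h y::'a)"
  shows "F2_space (h ` (M::'a set))"
proof -
  have "h 0 = 0" using assms(2)[of 0 0] by (simp add: add_self)
  then show ?thesis using assms unfolding F2_space_def by (metis imageE imageI)
qed

lemma card_image_F2_space:
  assumes "F2_space M" "\<And>x y. h (x + y) = h x + (h y::'a)"
  shows "card (M::'a set) = card {x \<in> M. h x = 0} * card (h ` M)"
proof -
  have "{x \<in> M. h x \<in> h ` M} = M" by blast
  then show ?thesis
    using preimage_F2_space(3)[OF assms image_F2_space[OF assms] subset_refl] by simp
qed

text \<open>
  Every space between \<open>U\<close> and \<open>M\<close> is a preimage of this form. Its elements outside \<open>U\<close> form cosets of \<open>U\<close>, one for each nonzero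
  element \<open>t\<close> of \<open>T\<close>, and the coset over \<open>t\<close> contributes \<open>nonzero_prod U / t\<close>.
\<close>

lemma preimage_inv_sum:
  assumes "F2_space (U::'a set)" "F2_space M" "F2_space T" "U \<subseteq> M" "T \<subseteq> vanishing U ` M"
  defines "V \<equiv> {x \<in> M. vanishing U x \<in> T}"
  shows "F2_space V" "card V = card U * card T"
    "inv_sum V = inv_sum U + nonzero_prod U * inv_sum T"
proof -
  note add = vanishing_add[OF assms(1)]
  note pre = preimage_F2_space[OF assms(2) add assms(3,5), folded V_def]
  have ker: "{x \<in> M. vanishing U x = 0} = U"
    using assms(4) by (auto simp: vanishing_eq_0_iff)
  show "F2_space V" "card V = card U * card T"
    using pre ker by simp_all
  have "inv_sum V = (\<Sum>t\<in>T. \<Sum>x\<in>{x \<in> V. vanishing U x = t}. inverse x)"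
    unfolding inv_sum_def pre(2)[symmetric] by (rule sum.image_gen) simp
  also have "\<dots> = (\<Sum>x\<in>{x \<in> V. vanishing U x = 0}. inverse x)
      + (\<Sum>t\<in>T - {0}. \<Sum>x\<in>{x \<in> V. vanishing U x = t}. inverse x)"
    using F2_spaceD(1)[OF assms(3)] by (intro sum.remove) auto
  also have "{x \<in> V. vanishing U x = 0} = {x \<in> M. vanishing U x = 0}"
    using F2_spaceD(1)[OF assms(3)] by (auto simp: V_def)
  also note ker
  also have "(\<Sum>t\<in>T - {0}. \<Sum>x\<in>{x \<in> V. vanishing U x = t}. inverse x)
      = (\<Sum>t\<in>T - {0}. nonzero_prod U * inverse t)"
  proof (rule sum.cong)
    fix t assume t: "t \<in> T - {0}"
    then obtain a where a: "a \<in> M" "t = vanishing U a" using assms(5) by auto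
    have "{x \<in> V. vanishing U x = t} = {x \<in> M. vanishing U x = vanishing U a}"
      using a t by (auto simp: V_def)
    also have "\<dots> = (+) a ` U" using fiber_eq_coset[OF assms(2) add a(1)] ker by simp
    finally have "(\<Sum>x\<in>{x \<in> V. vanishing U x = t}. inverse x) = (\<Sum>v\<in>U. inverse (a + v))"
      by (simp add: sum.reindex)
    also have "\<dots> = nonzero_prod U * inverse t"
      using a t by (subst coset_inv_sum[OF assms(1)]) (auto simp: vanishing_eq_0_iff divide_inverse)
    finally show "(\<Sum>x\<in>{x \<in> V. vanishing U x = t}. inverse x) = nonzero_prod U * inverse t" .
  qed simp
  also have "\<dots> = nonzero_prod U * inv_sum T"
    unfolding inv_sum_def sum_distrib_left by (intro sum.mono_neutral_left) auto
  finally show "inv_sum V = inv_sum U + nonzero_prod U * inv_sum T"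
    by (simp add: inv_sum_def)
qed

lemma inv_sum_scale: "inv_sum ((*) (c::'a) ` V) = inverse c * inv_sum V"
proof (cases "c = 0")
  case True
  have "inv_sum ((*) c ` V) = 0" unfolding inv_sum_def using True by (intro sum.neutral) auto
  then show ?thesis using True by simp
next
  case False
  then show ?thesis
    unfolding inv_sum_def sum_distrib_left by (subst sum.reindex) (auto simp: inj_on_def)
qed

lemma F2_space_scale: "F2_space V \<Longrightarrow> F2_space ((*) (c::'a) ` V)"
  by (rule image_F2_space) (auto simp: algebra_simps)

lemma card_scale: "(c::'a) \<noteq> 0 \<Longrightarrow> card ((*) c ` V) = card V"
  by (rule card_image) (auto simp: inj_on_def)

text \<open>
  Multiplication by \<open>c\<close> permutes \<open>V\<close> but divides the inverse sum by \<open>c\<close>.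
\<close>

lemma inv_sum_eq_0_of_closed:
  assumes "\<And>x. x \<in> V \<Longrightarrow> c * x \<in> V" "c \<noteq> 0" "(c::'a) \<noteq> 1"
  shows "inv_sum V = 0"
proof -
  have "(*) c ` V = V"
    using assms by (intro endo_inj_surj) (auto simp: inj_on_def)
  then have "inv_sum V = inverse c * inv_sum V"
    using inv_sum_scale[of c V] by simp
  then have "(c - 1) * inv_sum V = 0" using assms(2) by (simp add: field_simps)
  then show ?thesis using assms(3) by simp
qed

text \<open>
  The whole field has inverse sum zero, and it is the preimage of the range of \<open>vanishing V\<close>; this range
  is the space \<open>W\<close>.
\<close>

lemma inv_sum_dual:
  assumes "F2_space (V::'a set)" "CARD('a) > 2"
  shows "\<exists>W. F2_space W \<and> card V * card W = CARD('a) \<and>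
    inv_sum V + nonzero_prod V * inv_sum (W::'a set) = 0"
proof -
  have "\<not> UNIV \<subseteq> {0, 1::'a}"
    using card_mono[of "{0,1::'a}" UNIV] assms(2) by auto
  then obtain c :: 'a where c: "c \<noteq> 0" "c \<noteq> 1" by auto
  have UN: "F2_space (UNIV::'a set)" by (simp add: F2_space_def)
  have W: "F2_space (range (vanishing V))"
    using image_F2_space[OF UN vanishing_add[OF assms(1)]] .
  have zero: "inv_sum (UNIV :: 'a set) = 0"
    by (rule inv_sum_eq_0_of_closed[OF _ c]) auto
  have all: "{x \<in> UNIV. vanishing V x \<in> range (vanishing V)} = UNIV"
    by blast
  note ext = preimage_inv_sum(2,3)[OF assms(1) UN W subset_UNIV subset_refl, unfolded all zero]
  show ?thesis
    by (intro exI[of _ "range (vanishing V)"] conjI W ext(1)[symmetric] ext(2)[symmetric])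
qed

section \<open>Frobenius powers and the kernels they define\<close>

lemma frob_add: "frob j (x + y) = frob j x + frob j (y::'a)"
  unfolding frob_def using freshmans_dream'[of "2 ^ j" j x y] char_two by simp

lemma frob_0 [simp]: "frob j (0::'a) = 0"
  by (simp add: frob_def)

lemma frob_eq_0_iff [simp]: "frob j (x::'a) = 0 \<longleftrightarrow> x = 0"
  by (simp add: frob_def)

lemma frob_id [simp]: "frob 0 (x::'a) = x"
  by (simp add: frob_def)

lemma frob_frob: "frob i (frob j (x::'a)) = frob (i + j) x"
  by (simp add: frob_def power_add mult.commute flip: power_mult)

lemma frob_mult: "frob j (x * y) = frob j x * frob j (y::'a)"
  by (simp add: frob_def power_mult_distrib)

lemma frob_inverse: "frob j (inverse x) = inverse (frob j (x::'a))"
  by (simp add: frob_def power_inverse)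

lemma frob_inj: "frob j x = frob j y \<longleftrightarrow> x = (y::'a)"
  by (metis add_eq_0 frob_add frob_eq_0_iff)

lemma frob_sum: "frob j (sum g I) = (\<Sum>i\<in>I. frob j (g i :: 'a))"
  by (induction I rule: infinite_finite_induct) (simp_all add: frob_add)

lemma frob_prod: "frob j (prod g I) = (\<Prod>i\<in>I. frob j (g i :: 'a))"
  by (simp add: frob_def prod_power_distrib)

lemma frob_card: "CARD('a) = 2 ^ n \<Longrightarrow> frob n (x::'a) = x"
  unfolding frob_def by (metis finite_field_power_card_eq_same)

lemma frob_image:
  assumes "frob j ` (U::'a set) \<subseteq> U"
  shows "frob j ` U = U"
  using assms by (intro endo_inj_surj) (auto simp: inj_on_def frob_inj)

lemma frob_bij: "frob j ` (U::'a set) \<subseteq> U \<Longrightarrow> bij_betw (frob j) U U"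
  by (simp add: bij_betw_def frob_image inj_on_def frob_inj)

lemma frob_inv_sum:
  assumes "frob j ` (U::'a set) \<subseteq> U"
  shows "frob j (inv_sum U) = inv_sum U"
  unfolding inv_sum_def frob_sum frob_inverse
  using sum.reindex_bij_betw[OF frob_bij[OF assms], of inverse] .

lemma frob_vanishing:
  assumes "frob j ` (U::'a set) \<subseteq> U"
  shows "frob j (vanishing U x) = vanishing U (frob j x)"
  unfolding vanishing_def frob_prod frob_add
  using prod.reindex_bij_betw[OF frob_bij[OF assms], of "\<lambda>v. frob j x + v"] .

lemma frob_nonzero_prod:
  assumes "frob j ` (U::'a set) \<subseteq> U"
  shows "frob j (nonzero_prod U) = nonzero_prod U"
proof -
  have "frob j ` (U - {0}) \<subseteq> U - {0}" using assms by auto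
  from prod.reindex_bij_betw[OF frob_bij[OF this], of "\<lambda>v. v"]
  show ?thesis by (simp add: nonzero_prod_def frob_prod)
qed

text \<open>
  This bounds from below the size of a kernel \<open>K\<close> whose elements are not known explicitly: it suffices to find an additive map of small degree, hence with
  few zeros, whose values lie in \<open>K\<close>.
\<close>

lemma card_le_ker_image:
  assumes "F2_space M" "\<And>x y. h (x + y) = h x + (h y::'a)"
    "card {x. h (x::'a) = 0} \<le> d" "h ` M \<subseteq> K"
  shows "card M \<le> d * card K"
proof -
  have "card {x \<in> M. h x = 0} \<le> card {x. h x = 0}" by (rule card_mono) auto
  also have "\<dots> \<le> d" by fact
  finally show ?thesis
    using card_image_F2_space[OF assms(1,2)] card_mono[OF finite assms(4)]
    by (metis mult_le_mono)
qed

lemma card_roots_frob_sum: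
  assumes "finite J" "J \<noteq> {}" "\<And>j. j \<in> J \<Longrightarrow> j \<le> d"
  shows "card {x::'a. (\<Sum>j\<in>J. frob j x) = 0} \<le> 2 ^ d"
proof -
  define p :: "'a poly" where "p = (\<Sum>j\<in>J. monom 1 (2 ^ j))"
  obtain i where i: "i \<in> J" using assms(2) by auto
  have "coeff p (2 ^ i) = (\<Sum>j\<in>J. if j = i then 1 else 0)"
    unfolding p_def coeff_sum by (intro sum.cong) auto
  then have "p \<noteq> 0" using i assms(1) by auto
  then have "card {x. poly p x = 0} \<le> degree p" by (rule card_poly_roots_bound)
  also have deg: "degree p \<le> 2 ^ d" unfolding p_def
    using assms by (intro degree_sum_le) (auto intro!: degree_monom_le[THEN order_trans])
  finally show ?thesis
    by (simp add: p_def poly_sum poly_monom frob_def)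
qed

definition fixed_field :: "nat \<Rightarrow> 'a set" where
  "fixed_field j = {x. frob j x = x}"

text \<open>
  The kernels of \<open>X^3 + X^2 + 1\<close> and of \<open>X^3 + X + 1\<close> evaluated at \<open>frob j\<close>; the digits are the exponents
  that occur.
\<close>

definition ker_320 :: "nat \<Rightarrow> 'a set" where
  "ker_320 j = {x. frob (3*j) x + frob (2*j) x + x = 0}"

definition ker_310 :: "nat \<Rightarrow> 'a set" where
  "ker_310 j = {x. frob (3*j) x + frob j x + x = 0}"

lemma F2_space_UNIV: "F2_space (UNIV::'a set)"
  by (simp add: F2_space_def)

lemma F2_space_kernel:
  assumes "\<And>x y. h (x + y) = h x + (h y::'a)"
  shows "F2_space {x::'a. h x = 0}"
proof -
  have "h 0 = 0" using assms[of 0 0] by (simp add: add_self)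
  then show ?thesis by (simp add: F2_space_def assms)
qed

lemma F2_space_fixed: "F2_space (fixed_field j)"
  by (simp add: F2_space_def fixed_field_def frob_add)

lemma F2_space_ker_320: "F2_space (ker_320 j)"
  unfolding ker_320_def by (rule F2_space_kernel) (simp only: frob_add ac_simps)

lemma F2_space_ker_310: "F2_space (ker_310 j)"
  unfolding ker_310_def by (rule F2_space_kernel) (simp only: frob_add ac_simps)

lemma sum_frob_add: "(\<Sum>j\<in>J. frob j (x + y)) = (\<Sum>j\<in>J. frob j x) + (\<Sum>j\<in>J. frob j (y::'a))"
  by (simp add: frob_add sum.distrib)

text \<open>
  The trace from the whole field to \<open>fixed_field m\<close> takes its values there, and it has degree
  \<open>2 ^ ((d - 1) * m)\<close>.
\<close>

lemma card_fixed_field_ge: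
  assumes "CARD('a) = 2 ^ (d * m)" "d > 0" "m > 0"
  shows "2 ^ m \<le> card (fixed_field m)"
proof -
  define J where "J = (\<lambda>i. i * m) ` {..<d}"
  have inj: "inj_on (\<lambda>i. i * m) {..<d}" using assms(3) by (auto simp: inj_on_def)
  have eq: "(\<Sum>j\<in>J. frob j x) = (\<Sum>i<d. frob (i * m) x)" for x :: 'a
    unfolding J_def using inj by (simp add: sum.reindex)
  have "(\<Sum>j\<in>J. frob j x) \<in> fixed_field m" for x :: 'a
  proof -
    have "frob m (\<Sum>j\<in>J. frob j x) + frob 0 x = (\<Sum>i<d. frob (Suc i * m) x) + frob (0 * m) x"
      unfolding eq frob_sum frob_frob by simp
    also have "\<dots> = (\<Sum>i<Suc d. frob (i * m) x)"
      by (subst sum.lessThan_Suc_shift) (simp add: add.commute)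
    also have "\<dots> = (\<Sum>j\<in>J. frob j x) + x"
      unfolding eq using frob_card[OF assms(1), of x] by simp
    finally show ?thesis by (simp add: fixed_field_def)
  qed
  moreover have "j \<le> (d - 1) * m" if "j \<in> J" for j
    using that by (auto simp: J_def)
  then have "card {x::'a. (\<Sum>j\<in>J. frob j x) = 0} \<le> 2 ^ ((d - 1) * m)"
    using assms(2) by (intro card_roots_frob_sum) (auto simp: J_def)
  ultimately have "CARD('a) \<le> 2 ^ ((d - 1) * m) * card (fixed_field m)"
    by (intro card_le_ker_image[OF F2_space_UNIV sum_frob_add]) auto
  moreover have "2 ^ (d * m) = 2 ^ ((d - 1) * m) * (2 ^ m :: nat)"
    using assms(2) by (cases d) (simp_all flip: power_add)
  ultimately show ?thesis using assms(1) by simp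
qed

lemma card_fixed_field_le: "m > 0 \<Longrightarrow> card (fixed_field m) \<le> 2 ^ m"
  using card_roots_frob_sum[of "{0, m}" m] by (fastforce simp: fixed_field_def add_eq_0 eq_commute[of _ "frob m _"])

text \<open>
  The cofactor of \<open>X^3 + X^2 + 1\<close> in \<open>X^7 + 1\<close> is \<open>X^4 + X^3 + X^2 + 1\<close>, so evaluating the cofactor at
  \<open>frob m\<close> gives values in the kernel.
\<close>

lemma card_ker_320_ge:
  assumes "CARD('a) = 2 ^ (7 * m)" "m > 0"
  shows "8 ^ m \<le> card (ker_320 m)"
proof -
  let ?J = "{0, 2 * m, 3 * m, 4 * m}"
  have eq: "(\<Sum>j\<in>?J. frob j x) = x + (frob (2*m) x + (frob (3*m) x + frob (4*m) x))" for x :: 'a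
    using assms(2) by simp
  have "(\<Sum>j\<in>?J. frob j x) \<in> ker_320 m" for x :: 'a
  proof -
    have f: "frob (3*m) (frob (4*m) x) = x" "frob (2*m) (frob (2*m) x) = frob (4*m) x"
      "frob (2*m) (frob (3*m) x) = frob (5*m) x" "frob (2*m) (frob (4*m) x) = frob (6*m) x"
      "frob (3*m) (frob (2*m) x) = frob (5*m) x" "frob (3*m) (frob (3*m) x) = frob (6*m) x"
      using frob_card[OF assms(1)] by (simp_all add: frob_frob)
    show ?thesis
      unfolding eq ker_320_def by (simp only: mem_Collect_eq frob_add f) (simp only: ring_char2)
  qed
  then have "CARD('a) \<le> 2 ^ (4 * m) * card (ker_320 m)"
    by (intro card_le_ker_image[OF F2_space_UNIV sum_frob_add[where J = ?J] card_roots_frob_sum]) auto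
  moreover have "2 ^ (7 * m) = 2 ^ (4 * m) * (8 ^ m :: nat)"
    by (simp add: power_mult flip: power_mult_distrib)
  ultimately show ?thesis using assms(1) by simp
qed

text \<open>
  Likewise with the cofactor \<open>X^4 + X^2 + X + 1\<close> of \<open>X^3 + X + 1\<close>.
\<close>

lemma card_ker_310_ge:
  assumes "CARD('a) = 2 ^ (7 * m)" "m > 0"
  shows "8 ^ m \<le> card (ker_310 m)"
proof -
  let ?J = "{0, m, 2 * m, 4 * m}"
  have eq: "(\<Sum>j\<in>?J. frob j x) = x + (frob m x + (frob (2*m) x + frob (4*m) x))" for x :: 'a
    using assms(2) by simp
  have "(\<Sum>j\<in>?J. frob j x) \<in> ker_310 m" for x :: 'a
  proof -
    have f: "frob (3*m) (frob (4*m) x) = x" "frob m (frob m x) = frob (2*m) x"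
      "frob m (frob (2*m) x) = frob (3*m) x" "frob m (frob (4*m) x) = frob (5*m) x"
      "frob (3*m) (frob m x) = frob (4*m) x" "frob (3*m) (frob (2*m) x) = frob (5*m) x"
      using frob_card[OF assms(1)] by (simp_all add: frob_frob flip: mult_2)
    show ?thesis
      unfolding eq ker_310_def by (simp only: mem_Collect_eq frob_add f) (simp only: ring_char2)
  qed
  then have "CARD('a) \<le> 2 ^ (4 * m) * card (ker_310 m)"
    by (intro card_le_ker_image[OF F2_space_UNIV sum_frob_add[where J = ?J] card_roots_frob_sum]) auto
  moreover have "2 ^ (7 * m) = 2 ^ (4 * m) * (8 ^ m :: nat)"
    by (simp add: power_mult flip: power_mult_distrib)
  ultimately show ?thesis using assms(1) by simp
qed

lemma card_ker_320_le:
  assumes "m > 0"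
  shows "card (ker_320 m) \<le> 8 ^ m"
proof -
  have "(\<Sum>j\<in>{0, 2 * m, 3 * m}. frob j x) = frob (3*m) x + frob (2*m) x + x" for x :: 'a
    using assms by (simp add: ac_simps)
  then have "card (ker_320 m) \<le> 2 ^ (3 * m)"
    unfolding ker_320_def using card_roots_frob_sum[of "{0, 2 * m, 3 * m}" "3 * m"] by fastforce
  then show ?thesis by (simp add: power_mult)
qed

section \<open>Frobenius-stable spaces with eight elements\<close>

lemma span2:
  assumes "(a::'a) \<noteq> 0" "b \<notin> {0, a}"
  defines "P \<equiv> {0, a, b, a + b}"
  shows "F2_space P" "card P = 4" "nonzero_prod P = a * (b * (b + a))"
    "vanishing P x = x * (x + a) * (x * (x + a) + b * (b + a))"
    "inv_sum P = (a^2 + a*b + b^2) / (a * (b * (b + a)))"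
proof -
  have V0: "F2_space {0::'a}" by (simp add: F2_space_def)
  have e1: "{0} \<union> (+) a ` {0} = {0, a}" by auto
  have e2: "{0, a} \<union> (+) b ` {0, a} = P" by (auto simp: add.commute P_def)
  have V1: "F2_space {0, a}" using F2_space_double[OF V0, of a] e1 by simp
  show "F2_space P" using F2_space_double[OF V1, of b] e2 by simp
  show "card P = 4" unfolding P_def using assms(1,2) by (auto simp: card_insert_if add_eq_0)
  have L1: "vanishing {0, a} y = y * (y + a)" for y by (simp add: vanishing_def assms(1)[symmetric])
  show "vanishing P x = x * (x + a) * (x * (x + a) + b * (b + a))"
    using vanishing_double[OF V1 assms(2), of x] vanishing_add[OF V1, of x b] unfolding e2 L1 by simp
  have w1: "nonzero_prod {0, a} = a" using assms(1) by (simp add: nonzero_prod_def)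
  show "nonzero_prod P = a * (b * (b + a))"
    using nonzero_prod_double[OF V1 assms(2)] unfolding e2 w1 L1 .
  have S1: "inv_sum {0, a} = inverse a" using assms(1) by (simp add: inv_sum_def)
  have nz: "b \<noteq> 0" "b + a \<noteq> 0" using assms(1,2) by (auto simp: add_eq_0)
  have "inv_sum P = inverse a + a / (b * (b + a))"
    using inv_sum_double[OF V1 assms(2)] unfolding e2 w1 L1 S1 .
  also have "inverse a + a / (b * (b + a)) = (b * (b + a) + a * a) / (a * (b * (b + a)))"
    using assms(1) nz by (simp add: divide_simps)
  also have "b * (b + a) + a * a = a^2 + a*b + b^2"
    by (simp only: power2_eq_square) (simp only: ring_char2)
  finally show "inv_sum P = (a^2 + a*b + b^2) / (a * (b * (b + a)))" .
qed

lemma span3: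
  assumes "(a::'a) \<noteq> 0" "b \<notin> {0, a}" "c \<notin> {0, a, b, a + b}"
  shows "F2_space (span3 a b c)" "card (span3 a b c) = 8"
    "inv_sum (span3 a b c) = 0 \<longleftrightarrow> span3_numerator a b c = 0"
proof -
  let ?P = "{0, a, b, a + b}" and ?A = "a^2 + a*b + b^2" and ?w = "a * (b * (b + a))"
  note span2 = span2[OF assms(1,2)]
  have e: "?P \<union> (+) c ` ?P = span3 a b c"
    by (auto simp: span3_def add.commute)
  show "F2_space (span3 a b c)" using F2_space_double[OF span2(1), of c] e by simp
  have "card (span3 a b c) = card ?P + card ((+) c ` ?P)"
    unfolding e[symmetric] by (intro card_Un_disjoint coset_disjoint span2(1) assms(3)) auto
  then show "card (span3 a b c) = 8" using span2(2) by (simp only: card_image[OF inj_on_add])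
  have Lc: "vanishing ?P c \<noteq> 0" using assms(3) vanishing_eq_0_iff by blast
  have "b \<noteq> 0" "b + a \<noteq> 0" using assms by (auto simp: add_eq_0)
  then have w: "?w \<noteq> 0" using assms(1) by simp
  have "inv_sum (span3 a b c) = ?A / ?w + ?w / vanishing ?P c"
    using inv_sum_double[OF span2(1) assms(3)] unfolding e span2(3,5) .
  also have "\<dots> = (?A * vanishing ?P c + ?w * ?w) / (?w * vanishing ?P c)"
    using Lc w by (simp add: add_frac_eq)
  also have "?A * vanishing ?P c + ?w * ?w = span3_numerator a b c"
    unfolding span2(4) span3_numerator_def
    by (simp only: power2_eq_square power4_eq_xxxx) (simp only: ring_char2)
  finally show "inv_sum (span3 a b c) = 0 \<longleftrightarrow> span3_numerator a b c = 0"
    using Lc w by simp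
qed

lemma frob_span3: "frob j ` span3 a b c = span3 (frob j a) (frob j b) (frob j (c::'a))"
  by (simp add: span3_def frob_add)

lemma span3_subset: "F2_space V \<Longrightarrow> a \<in> V \<Longrightarrow> b \<in> V \<Longrightarrow> (c::'a) \<in> V \<Longrightarrow> span3 a b c \<subseteq> V"
  by (auto simp: span3_def F2_spaceD)

lemma span3_gens: "a \<in> span3 a b c" "b \<in> span3 a b c" "c \<in> span3 a b (c::'a)"
  "a + b \<in> span3 a b c" "a + c \<in> span3 a b c"
  by (auto simp: span3_def)

text \<open>
  On \<open>ker_320 j\<close> and \<open>ker_310 j\<close> the map \<open>frob j\<close> generates a field with 8 elements, because both cubics are
  irreducible. The lines over that field are spanned by \<open>x\<close> and its first two images.
\<close>

definition line :: "nat \<Rightarrow> 'a \<Rightarrow> 'a set" where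
  "line j x = span3 x (frob j x) (frob (2 * j) x)"

lemma frob_suc: "frob j (frob (2 * j) (x::'a)) = frob (3 * j) x" "frob j (frob j x) = frob (2 * j) x"
  by (simp_all add: frob_frob flip: mult_2)

lemma frob_fixed_mult: "frob j x = (x::'a) \<Longrightarrow> frob (k * j) x = x"
  by (induction k) (simp_all flip: frob_frob)

lemma line_stable:
  assumes "F2_space (line j x)" "frob (3 * j) x \<in> line j x"
  shows "frob j ` line j (x::'a) \<subseteq> line j x"
  unfolding line_def frob_span3 frob_suc
  by (intro span3_subset) (use assms span3_gens in \<open>auto simp: line_def\<close>)

text \<open>
  A linear relation between \<open>x\<close>, \<open>frob j x\<close> and \<open>frob (2 * j) x\<close> would be given by a polynomial of degree at most 2,
  which is coprime to \<open>X^3 + X^2 + 1\<close>; the cases below exclude such relations one by one.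
\<close>

lemma line_ker_320:
  assumes "x \<in> ker_320 j" "x \<noteq> 0"
  shows "F2_space (line j x)" "card (line j x) = 8" "frob j ` line j x \<subseteq> line j x"
    "inv_sum (line j x) = 0 \<longleftrightarrow> span3_numerator x (frob j x) (frob (2 * j) x) = 0"
proof -
  have "frob (3 * j) x + (x + frob (2 * j) x) = 0"
    using assms(1) by (simp add: ker_320_def ac_simps)
  then have r: "frob (3 * j) x = x + frob (2 * j) x"
    by (simp only: add_eq_0)
  have 1: "frob j x \<noteq> x"
  proof
    assume *: "frob j x = x"
    then show False using r frob_fixed_mult[OF *] assms(2) by (simp add: add_self)
  qed
  have 2: "frob (2 * j) x \<noteq> x"
  proof
    assume *: "frob (2 * j) x = x"
    then have "frob j x = 0" using r frob_suc(1)[of j x] by (simp add: add_self)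
    then show False using assms(2) by simp
  qed
  have 3: "frob (2 * j) x \<noteq> frob j x"
    using 1 by (metis frob_suc(2) frob_inj)
  have 4: "frob (2 * j) x \<noteq> x + frob j x"
  proof
    assume *: "frob (2 * j) x = x + frob j x"
    have "frob (3 * j) x = frob j x + frob (2 * j) x"
      by (metis * frob_add frob_suc)
    then show False using r 1 by simp
  qed
  note t = span3[OF assms(2), of "frob j x" "frob (2 * j) x", folded line_def]
  show "F2_space (line j x)" "card (line j x) = 8"
    "inv_sum (line j x) = 0 \<longleftrightarrow> span3_numerator x (frob j x) (frob (2 * j) x) = 0"
    using t 1 2 3 4 assms(2) by simp_all
  then show "frob j ` line j x \<subseteq> line j x"
    by (intro line_stable) (auto simp: r line_def span3_gens)
qed

lemma line_ker_310:
  assumes "x \<in> ker_310 j" "x \<noteq> 0"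
  shows "F2_space (line j x)" "card (line j x) = 8" "frob j ` line j x \<subseteq> line j x"
proof -
  have "frob (3 * j) x + (x + frob j x) = 0"
    using assms(1) by (simp add: ker_310_def ac_simps)
  then have r: "frob (3 * j) x = x + frob j x"
    by (simp only: add_eq_0)
  have 1: "frob j x \<noteq> x"
  proof
    assume *: "frob j x = x"
    then show False using r frob_fixed_mult[OF *] assms(2) by (simp add: add_self)
  qed
  have 2: "frob (2 * j) x \<noteq> x"
  proof
    assume *: "frob (2 * j) x = x"
    then show False using r frob_suc(1)[of j x] assms(2) by simp
  qed
  have 3: "frob (2 * j) x \<noteq> frob j x"
    using 1 by (metis frob_suc(2) frob_inj)
  have 4: "frob (2 * j) x \<noteq> x + frob j x"
  proof
    assume *: "frob (2 * j) x = x + frob j x"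
    have "frob (3 * j) x = frob j x + frob (2 * j) x"
      by (metis * frob_add frob_suc)
    then have "frob (3 * j) x = x" using * by (simp add: add.left_commute add_self)
    then show False using r assms(2) by simp
  qed
  note t = span3[OF assms(2), of "frob j x" "frob (2 * j) x", folded line_def]
  show "F2_space (line j x)" "card (line j x) = 8"
    using t 1 2 3 4 assms(2) by simp_all
  then show "frob j ` line j x \<subseteq> line j x"
    by (intro line_stable) (auto simp: r line_def span3_gens)
qed

lemma frob_stable_mult: "frob j ` (U::'a set) \<subseteq> U \<Longrightarrow> frob (k * j) ` U \<subseteq> U"
proof (induction k)
  case (Suc k)
  then show ?case by (auto simp flip: frob_frob)
qed simp

lemma frob_ker_320: "x \<in> ker_320 j \<Longrightarrow> frob k x \<in> ker_320 j"
proof -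
  assume "x \<in> ker_320 j"
  moreover have "frob (3*j) (frob k x) + frob (2*j) (frob k x) + frob k x
      = frob k (frob (3*j) x + frob (2*j) x + x)"
    by (simp add: frob_add frob_frob ac_simps)
  ultimately show ?thesis by (simp add: ker_320_def)
qed

lemma frob_ker_310: "x \<in> ker_310 j \<Longrightarrow> frob k x \<in> ker_310 j"
proof -
  assume "x \<in> ker_310 j"
  moreover have "frob (3*j) (frob k x) + frob j (frob k x) + frob k x
      = frob k (frob (3*j) x + frob j x + x)"
    by (simp add: frob_add frob_frob ac_simps)
  ultimately show ?thesis by (simp add: ker_310_def)
qed

lemma vanishing_ker_320:
  assumes "F2_space U" "frob j ` U \<subseteq> U" "x \<in> ker_320 j"
  shows "vanishing U x \<in> ker_320 j"
proof -
  have "frob (3*j) (vanishing U x) + frob (2*j) (vanishing U x) + vanishing U x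
      = vanishing U (frob (3*j) x + frob (2*j) x + x)"
    by (simp only: vanishing_add[OF assms(1)] frob_vanishing[OF frob_stable_mult[OF assms(2)]])
  then show ?thesis using assms(3) F2_spaceD(1)[OF assms(1)]
    by (simp add: ker_320_def vanishing_eq_0_iff)
qed

lemma vanishing_ker_310:
  assumes "F2_space U" "frob j ` U \<subseteq> U" "x \<in> ker_310 j"
  shows "vanishing U x \<in> ker_310 j"
proof -
  have "frob (3*j) (vanishing U x) + frob j (vanishing U x) + vanishing U x
      = vanishing U (frob (3*j) x + frob j x + x)"
    by (simp only: vanishing_add[OF assms(1)] frob_vanishing[OF frob_stable_mult[OF assms(2)]]
        frob_vanishing[OF assms(2)])
  then show ?thesis using assms(3) F2_spaceD(1)[OF assms(1)]
    by (simp add: ker_310_def vanishing_eq_0_iff)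
qed

lemma vanishing_fixed:
  assumes "frob j ` U \<subseteq> U" "x \<in> fixed_field j"
  shows "vanishing U x \<in> fixed_field j"
  using assms by (simp add: fixed_field_def frob_vanishing)

text \<open>
  Two spaces that meet only in \<open>0\<close>: the map with kernel \<open>U\<close> is injective on \<open>D\<close>, and \<open>D\<close> is finite.
\<close>

lemma vanishing_onto:
  assumes "F2_space U" "F2_space D" "U \<inter> D = {0}" "\<And>x. x \<in> D \<Longrightarrow> vanishing U x \<in> (D::'a set)"
  shows "vanishing U ` D = D"
proof (rule endo_inj_surj)
  show "inj_on (vanishing U) D"
  proof (rule inj_onI)
    fix x y assume xy: "x \<in> D" "y \<in> D" "vanishing U x = vanishing U y"
    then have "vanishing U (x + y) = 0" by (simp add: vanishing_add[OF assms(1)] add_self)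
    then have "x + y \<in> U \<inter> D" using xy F2_spaceD(2)[OF assms(2)] by (simp add: vanishing_eq_0_iff)
    then show "x = y" using assms(3) by (simp add: add_eq_0)
  qed
qed (use assms(4) in auto)

lemma ker_disjoint: "fixed_field j \<inter> ker_320 j = {0}" "fixed_field j \<inter> ker_310 j = {0}" "ker_320 j \<inter> ker_310 j = {0}"
proof -
  have fix0: "x = 0" if "frob j x = x" "x \<in> ker_320 j \<union> ker_310 j" for x
    using that frob_fixed_mult[OF that(1)] by (auto simp: ker_320_def ker_310_def add_self)
  have "x = 0" if "x \<in> ker_320 j" "x \<in> ker_310 j" for x
  proof (rule fix0)
    have "frob (3*j) x + frob (2*j) x + x = frob (3*j) x + frob j x + x"
      using that by (simp add: ker_320_def ker_310_def)
    then have "frob j (frob j x) = frob j x" by (simp add: frob_suc)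
    then show "frob j x = x" by (simp only: frob_inj)
  qed (use that in auto)
  moreover have "0 \<in> fixed_field j" "0 \<in> ker_320 j" "0 \<in> ker_310 j"
    by (simp_all add: F2_spaceD F2_space_fixed F2_space_ker_320 F2_space_ker_310)
  ultimately show "fixed_field j \<inter> ker_320 j = {0}" "fixed_field j \<inter> ker_310 j = {0}" "ker_320 j \<inter> ker_310 j = {0}"
    using fix0 by (auto simp: fixed_field_def)
qed

text \<open>
  A stable space \<open>U\<close> is enlarged by taking the preimage of a line under \<open>vanishing U\<close>. This preimage is again
  stable because \<open>vanishing U\<close> commutes with \<open>frob j\<close>.
\<close>

lemma stable_subspace_ker_310:
  assumes "8 ^ m \<le> card (ker_310 j)" "i \<le> m"
  shows "\<exists>U\<subseteq>ker_310 j. F2_space U \<and> frob j ` U \<subseteq> U \<and> card U = 8 ^ i"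
  using assms(2)
proof (induction i)
  case 0
  show ?case by (intro exI[of _ "{0}"]) (simp add: F2_space_def F2_spaceD(1)[OF F2_space_ker_310])
next
  case (Suc i)
  then obtain U where U: "U \<subseteq> ker_310 j" "F2_space U" "frob j ` U \<subseteq> U" "card U = 8 ^ i" by auto
  have "card U < card (ker_310 j)"
    using U(4) assms(1) Suc.prems power_strict_increasing[of i m "8::nat"] by linarith
  then obtain x where x: "x \<in> ker_310 j" "x \<notin> U"
    using card_mono[OF finite, of "ker_310 j" U] by (metis linorder_not_less subsetI)
  define t where "t = vanishing U x"
  have t: "t \<in> ker_310 j" "t \<noteq> 0"
    using vanishing_ker_310[OF U(2,3) x(1)] x(2) by (auto simp: t_def vanishing_eq_0_iff)
  have "frob k t \<in> vanishing U ` ker_310 j" if "k \<in> {0 * j, 1 * j, 2 * j}" for k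
  proof -
    have "frob k t = vanishing U (frob k x)"
      unfolding t_def using that frob_stable_mult[OF U(3)] by (intro frob_vanishing) blast
    then show ?thesis using frob_ker_310[OF x(1)] by blast
  qed
  from this[of "0 * j"] this[of "1 * j"] this[of "2 * j"]
  have sub: "line j t \<subseteq> vanishing U ` ker_310 j"
    unfolding line_def
    by (intro span3_subset image_F2_space[OF F2_space_ker_310 vanishing_add[OF U(2)]]) auto
  let ?V = "{y \<in> ker_310 j. vanishing U y \<in> line j t}"
  have "frob j ` ?V \<subseteq> ?V"
  proof
    fix z assume "z \<in> frob j ` ?V"
    then obtain y where y: "z = frob j y" "y \<in> ker_310 j" "vanishing U y \<in> line j t" by blast
    have "z \<in> ker_310 j" using y frob_ker_310 by simp
    moreover have "vanishing U z \<in> line j t"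
      using y line_ker_310(3)[OF t] by (auto simp flip: frob_vanishing[OF U(3)])
    ultimately show "z \<in> ?V" by simp
  qed
  then show ?case
    using preimage_inv_sum(1,2)[OF U(2) F2_space_ker_310 line_ker_310(1)[OF t] U(1) sub] U(4) line_ker_310(2)[OF t]
    by (intro exI[of _ ?V]) auto
qed

section \<open>Spaces with vanishing inverse sum\<close>

text \<open>
  With \<open>Q = 2 ^ m\<close>, the numerator of the inverse sum of the line through \<open>x\<close> is a polynomial in \<open>x\<close> with leading
  term \<open>x ^ (4 * Q^2 + 2 * Q)\<close>, obtained from \<open>b^2 * c^4\<close> at \<open>b = x ^ Q\<close> and \<open>c = x ^ Q^2\<close>. Its degree is
  less than \<open>Q^3\<close> once \<open>Q \<ge> 8\<close>, so it cannot vanish on all of \<open>ker_320 m\<close>.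
\<close>

lemma line_nonzero_inv_sum:
  assumes "8 ^ m \<le> card (ker_320 m)" "m \<ge> 3"
  shows "\<exists>x\<in>ker_320 m. x \<noteq> 0 \<and> span3_numerator x (frob m x) (frob (2 * m) x) \<noteq> 0"
proof (rule ccontr)
  define Q :: nat where "Q = 2 ^ m"
  define R where "R = Q ^ 2"
  assume "\<not> ?thesis"
  then have root: "span3_numerator x (frob m x) (frob (2 * m) x) = 0" if "x \<in> ker_320 m" for x
    using that by (cases "x = 0") (auto simp: span3_numerator_def)
  define X where "X k = monom (1::'a) k" for k
  \<comment> \<open>The factors of the numerator at \<open>a = x\<close>, \<open>b = x ^ Q\<close> and \<open>c = x ^ R\<close>, with the monomial of largest degree first.\<close>
  define A where "A = X (Q * 2) + (X 2 + X (1 + Q))"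
  define B where "B = X (R * 4) + (A * X (R * 2) + X (1 + Q) * (X 1 + X Q) * X R)"
  define p where "p = A * B + (X (1 + Q) * (X 1 + X Q)) ^ 2"
  have Q: "Q \<ge> 8"
    using power_increasing[of 3 m "2::nat"] assms(2) by (simp add: Q_def)
  then have R: "R \<ge> 8 * Q" by (simp add: R_def power2_eq_square)
  have dX: "degree (X k) = k" for k by (simp add: X_def degree_monom_eq)
  have dA: "degree A = Q * 2"
    unfolding A_def using Q by (subst degree_add_eq_left) (auto simp: dX intro!: degree_add_less)
  have le1: "degree (A * X (R * 2)) \<le> Q * 2 + R * 2"
    using degree_mult_le[of A "X (R * 2)"] by (simp add: dA dX)
  have le2: "degree (X (1 + Q) * (X 1 + X Q)) \<le> 1 + Q + Q"
    using degree_mult_le[of "X (1 + Q)" "X 1 + X Q"] degree_add_le[of "X 1" Q "X Q"] Q by (simp add: dX)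
  have le3: "degree (X (1 + Q) * (X 1 + X Q) * X R) \<le> 1 + Q + Q + R"
    using degree_mult_le[of "X (1 + Q) * (X 1 + X Q)" "X R"] le2 by (simp add: dX)
  have dB: "degree B = R * 4"
    unfolding B_def using Q R le1 le3
    by (subst degree_add_eq_left) (auto simp: dX intro!: degree_add_less)
  have nz: "A \<noteq> 0" "B \<noteq> 0" using dA dB Q R by auto
  have le4: "degree ((X (1 + Q) * (X 1 + X Q)) ^ 2) \<le> (1 + Q + Q) * 2"
    using mult_le_mono1[OF le2, of 2] degree_power_le[of "X (1 + Q) * (X 1 + X Q)" 2] by (rule order_trans[rotated])
  have dp: "degree p = Q * 2 + R * 4"
    unfolding p_def using Q R le4 nz
    by (subst degree_add_eq_left) (auto simp: degree_mult_eq dA dB)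
  have "poly p x = span3_numerator x (frob m x) (frob (2 * m) x)" for x
  proof -
    have f: "frob m x = x ^ Q" "frob (2 * m) x = x ^ R"
      by (simp_all add: frob_def Q_def R_def power_mult power2_eq_square mult.commute)
    show ?thesis
      unfolding f span3_numerator_def p_def A_def B_def X_def
      by (simp add: poly_monom power_add power_mult ac_simps)
  qed
  then have "ker_320 m \<subseteq> {x. poly p x = 0}" using root by auto
  then have "card (ker_320 m) \<le> card {x. poly p x = 0}" by (intro card_mono) auto
  also have "\<dots> \<le> degree p"
    using dp R Q by (intro card_poly_roots_bound) auto
  also have "degree p < Q * R"
    using dp R Q mult_le_mono1[of 8 Q R] by linarith
  also have "Q * R = 8 ^ m"
    by (simp add: Q_def R_def power2_eq_square flip: power_mult_distrib)
  finally show False using assms(1) by simp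
qed

lemma fixed_mult_frob: "c \<in> fixed_field j \<Longrightarrow> frob (k * j) (c * x) = c * frob (k * j) x"
  by (simp add: frob_mult frob_fixed_mult fixed_field_def)

lemma fixed_mult_ker_320:
  assumes "c \<in> fixed_field j" "x \<in> ker_320 j"
  shows "c * x \<in> ker_320 j"
proof -
  have "frob (3*j) (c * x) + frob (2*j) (c * x) + c * x = c * (frob (3*j) x + frob (2*j) x + x)"
    by (simp add: fixed_mult_frob[OF assms(1)] distrib_left)
  then show ?thesis using assms(2) by (simp add: ker_320_def)
qed

lemma F2_space_of_card:
  assumes "F2_space M" "2 ^ i \<le> card (M::'a set)"
  shows "\<exists>V\<subseteq>M. F2_space V \<and> card V = 2 ^ i"
  using assms(2)
proof (induction i)
  case 0
  show ?case using assms(1) by (intro exI[of _ "{0}"]) (simp add: F2_space_def)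
next
  case (Suc i)
  then obtain V where V: "V \<subseteq> M" "F2_space V" "card V = 2 ^ i" by auto
  have "card V < card M" using V(3) Suc.prems zero_less_power[of "2::nat" i] unfolding power_Suc by linarith
  then obtain x where x: "x \<in> M" "x \<notin> V"
    using card_mono[OF finite, of M V] unfolding linorder_not_le[symmetric] by blast
  let ?W = "V \<union> (+) x ` V"
  have "card ?W = card V + card ((+) x ` V)"
    by (intro card_Un_disjoint coset_disjoint V(2) x(2)) auto
  then have "card ?W = 2 ^ Suc i" using V(3) by (simp add: card_image)
  moreover have "?W \<subseteq> M" using V(1) x(1) F2_spaceD(2)[OF assms(1)] by blast
  ultimately show ?case using F2_space_double[OF V(2)] by blast
qed

lemma fixed_inverse: "c \<in> fixed_field j \<Longrightarrow> inverse c \<in> fixed_field j"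
  by (simp add: fixed_field_def frob_inverse)

lemma fixed_mult: "c \<in> fixed_field j \<Longrightarrow> d \<in> fixed_field j \<Longrightarrow> c * d \<in> fixed_field j"
  by (simp add: fixed_field_def frob_mult)

text \<open>
  Some space of the given dimension has nonzero inverse sum: adjoining two vectors with distinct images under
  \<open>vanishing V\<close> to the same \<open>V\<close> gives two distinct inverse sums. A multiple of it by an element of the subfield
  then attains the value \<open>s\<close>.
\<close>

lemma fixed_field_space_inv_sum:
  assumes "2 ^ Suc (Suc i) \<le> card (fixed_field m)" "s \<in> fixed_field m" "s \<noteq> 0"
  shows "\<exists>T\<subseteq>fixed_field m. F2_space T \<and> card T = 2 ^ Suc i \<and> inv_sum T = s"
proof -
  have "2 ^ i \<le> card (fixed_field m)" using assms(1) by simp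
  from F2_space_of_card[OF F2_space_fixed this]
  obtain V where V: "V \<subseteq> fixed_field m" "F2_space V" "card V = 2 ^ i" by auto
  have "card V < card (fixed_field m)"
    using V(3) assms(1) zero_less_power[of "2::nat" i] unfolding power_Suc by linarith
  then obtain x where x: "x \<in> fixed_field m" "x \<notin> V"
    using card_mono[OF finite, of "fixed_field m" V] unfolding linorder_not_le[symmetric] by blast
  have card2: "card (V \<union> (+) b ` V) = 2 ^ Suc i" if "b \<notin> V" for b
  proof -
    have "card (V \<union> (+) b ` V) = card V + card ((+) b ` V)"
      by (intro card_Un_disjoint coset_disjoint V(2) that) auto
    then show ?thesis using V(3) by (simp add: card_image)
  qed
  have "card (V \<union> (+) x ` V) < card (fixed_field m)"
    using card2[OF x(2)] assms(1) zero_less_power[of "2::nat" i] unfolding power_Suc by linarith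
  then obtain y where y: "y \<in> fixed_field m" "y \<notin> V" "y \<notin> (+) x ` V"
    using card_mono[OF finite, of "fixed_field m" "V \<union> (+) x ` V"]
    unfolding linorder_not_le[symmetric] by blast
  have "vanishing V x \<noteq> vanishing V y"
  proof
    assume "vanishing V x = vanishing V y"
    then have "vanishing V (x + y) = 0" by (simp add: vanishing_add[OF V(2)] add_self)
    then have "x + y \<in> V" by (simp add: vanishing_eq_0_iff)
    then have "x + (x + y) \<in> (+) x ` V" by blast
    then show False using y(3) by (simp only: add_self_left)
  qed
  moreover have "vanishing V x \<noteq> 0" "vanishing V y \<noteq> 0"
    using x y by (simp_all add: vanishing_eq_0_iff)
  ultimately have "nonzero_prod V / vanishing V x \<noteq> nonzero_prod V / vanishing V y"
    using nonzero_prod_nonzero[of V] by (simp add: divide_simps)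
  then have "inv_sum (V \<union> (+) x ` V) \<noteq> inv_sum (V \<union> (+) y ` V)"
    by (simp add: inv_sum_double[OF V(2)] x(2) y(2))
  then have "\<exists>b\<in>{x, y}. inv_sum (V \<union> (+) b ` V) \<noteq> 0" by auto
  then obtain b where b: "b \<in> fixed_field m" "b \<notin> V" "inv_sum (V \<union> (+) b ` V) \<noteq> 0"
    using x y by auto
  define W where "W = V \<union> (+) b ` V"
  have W: "F2_space W" "card W = 2 ^ Suc i" "inv_sum W \<noteq> 0" "W \<subseteq> fixed_field m"
    unfolding W_def
    subgoal by (rule F2_space_double[OF V(2)])
    subgoal by (rule card2[OF b(2)])
    subgoal by (rule b(3))
    subgoal using V(1) F2_spaceD(2)[OF F2_space_fixed b(1)] by blast
    done
  define c where "c = inv_sum W / s"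
  have "inv_sum W \<in> fixed_field m"
    unfolding inv_sum_def using W(4) fixed_inverse by (intro F2_space_sum[OF F2_space_fixed]) blast
  then have c: "c \<in> fixed_field m" "c \<noteq> 0"
    using W(3) assms(2,3) fixed_mult[OF _ fixed_inverse] by (auto simp: c_def divide_inverse)
  have "inv_sum ((*) c ` W) = s"
    unfolding inv_sum_scale c_def using W(3) by simp
  moreover have "(*) c ` W \<subseteq> fixed_field m" using fixed_mult[OF c(1)] W(4) by blast
  ultimately show ?thesis
    using F2_space_scale[OF W(1)] card_scale[OF c(2)] W(2)
    by (intro exI[of _ "(*) c ` W"]) simp
qed

lemma fixed_field_nontrivial:
  assumes "3 \<le> card (fixed_field m)"
  shows "\<exists>c\<in>fixed_field m. c \<noteq> 0 \<and> c \<noteq> 1"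
proof (rule ccontr)
  assume "\<not> ?thesis"
  then have "fixed_field m \<subseteq> {0, 1}" by auto
  from card_mono[OF _ this] show False using assms by simp
qed

text \<open>
  The space is the preimage of a multiple \<open>c * l\<close> of a line in \<open>ker_320 m\<close> under \<open>vanishing U\<close>, where \<open>U\<close> is stable
  inside \<open>ker_310 m\<close>. As \<open>c\<close> varies in the fixed field, its inverse sum \<open>S(U) + w(U) * S(l) / c\<close> takes different values,
  so it is nonzero for one of two choices of \<open>c\<close>.
\<close>

lemma stable_space_nonzero_inv_sum:
  assumes "CARD('a) = 2 ^ (7 * m)" "m \<ge> 3" "i \<le> m"
  shows "\<exists>U. F2_space U \<and> frob m ` U \<subseteq> U \<and> U \<inter> fixed_field m = {0} \<and> card U = 8 ^ Suc i \<and> inv_sum U \<noteq> 0"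
proof -
  have m: "m > 0" using assms(2) by simp
  obtain U where U: "U \<subseteq> ker_310 m" "F2_space U" "frob m ` U \<subseteq> U" "card U = 8 ^ i"
    using stable_subspace_ker_310[OF card_ker_310_ge[OF assms(1) m] assms(3)]
    by (elim exE conjE) (rule that)
  obtain x where x: "x \<in> ker_320 m" "x \<noteq> 0" "span3_numerator x (frob m x) (frob (2 * m) x) \<noteq> 0"
    using line_nonzero_inv_sum[OF card_ker_320_ge[OF assms(1) m] assms(2)] by blast
  note l = line_ker_320[OF x(1,2)]
  have "2 ^ 3 \<le> (2::nat) ^ m" using assms(2) by (intro power_increasing) auto
  then have big: "8 \<le> card (fixed_field m)" using card_fixed_field_ge[OF assms(1) _ m] by simp
  then obtain d where d: "d \<in> fixed_field m" "d \<noteq> 0" "d \<noteq> 1"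
    using fixed_field_nontrivial[of m] by auto
  have "1 \<in> fixed_field m" by (simp add: fixed_field_def frob_def)
  let ?f = "\<lambda>c. inv_sum U + nonzero_prod U * (inverse c * inv_sum (line m x))"
  have "?f 1 \<noteq> ?f d"
    using d l(4) x(3) nonzero_prod_nonzero[of U] by (auto simp: inverse_eq_1_iff)
  then have "?f 1 \<noteq> 0 \<or> ?f d \<noteq> 0" by metis
  then obtain c where c: "c \<in> fixed_field m" "c \<noteq> 0" "?f c \<noteq> 0"
    using d(1,2) \<open>1 \<in> fixed_field m\<close> one_neq_zero by meson
  let ?T = "(*) c ` line m x"
  have TD: "?T \<subseteq> ker_320 m"
  proof -
    have "line m x \<subseteq> ker_320 m"
      unfolding line_def by (intro span3_subset F2_space_ker_320 frob_ker_320 x(1))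
    then show ?thesis using fixed_mult_ker_320[OF c(1)] by blast
  qed
  have Tst: "frob m y \<in> ?T" if "y \<in> ?T" for y
  proof -
    obtain z where z: "z \<in> line m x" "y = c * z" using \<open>y \<in> ?T\<close> by blast
    then have "frob m y = c * frob m z" using c(1) by (simp add: frob_mult fixed_field_def)
    then show ?thesis using z(1) l(3) by blast
  qed
  have "U \<inter> ker_320 m = {0}"
  proof (rule equalityI)
    show "U \<inter> ker_320 m \<subseteq> {0}" unfolding ker_disjoint(3)[of m, symmetric] using U(1) by blast
  qed (simp add: F2_spaceD(1)[OF U(2)] F2_spaceD(1)[OF F2_space_ker_320])
  then have "vanishing U ` ker_320 m = ker_320 m"
    by (intro vanishing_onto U(2) F2_space_ker_320 vanishing_ker_320[OF U(2,3)])
  then have Tr: "?T \<subseteq> range (vanishing U)" using TD by blast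
  let ?V = "{y \<in> UNIV. vanishing U y \<in> ?T}"
  note ext = preimage_inv_sum[OF U(2) F2_space_UNIV F2_space_scale[OF l(1)] subset_UNIV Tr]
  have "card ?V = 8 ^ Suc i" using ext(2) U(4) l(2) card_scale[OF c(2)] by simp
  moreover have "inv_sum ?V \<noteq> 0" using ext(3) c(3) by (simp add: inv_sum_scale)
  moreover have "frob m ` ?V \<subseteq> ?V"
  proof
    fix z assume "z \<in> frob m ` ?V"
    then obtain y where "z = frob m y" "vanishing U y \<in> ?T" by blast
    then show "z \<in> ?V" using Tst[of "vanishing U y"] by (simp only: frob_vanishing[OF U(3)]) simp
  qed
  moreover have "?V \<inter> fixed_field m = {0}"
  proof -
    have "y = 0" if y: "vanishing U y \<in> ?T" "y \<in> fixed_field m" for y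
    proof -
      have "vanishing U y \<in> fixed_field m \<inter> ker_320 m"
        using vanishing_fixed[OF U(3) y(2)] y(1) TD by blast
      then have "vanishing U y = 0" unfolding ker_disjoint(1) by (rule singletonD)
      then have "y \<in> fixed_field m \<inter> ker_310 m"
        unfolding vanishing_eq_0_iff using y(2) U(1) by (intro IntI) (auto simp only: subset_iff)
      then show "y = 0" unfolding ker_disjoint(2) by (rule singletonD)
    qed
    then have "?V \<inter> fixed_field m \<subseteq> {0}" by (simp only: subset_iff Int_iff mem_Collect_eq singleton_iff) blast
    moreover have "{0} \<subseteq> ?V \<inter> fixed_field m"
      by (intro empty_subsetI insert_subsetI IntI F2_spaceD(1)[OF ext(1)] F2_spaceD(1)[OF F2_space_fixed])
    ultimately show ?thesis by (rule equalityI)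
  qed
  ultimately show ?thesis using ext(1) by (intro exI[of _ ?V]) simp
qed

text \<open>
  A stable space \<open>U\<close> as above is combined with a space \<open>T\<close> in the fixed field whose inverse sum cancels that of
  \<open>U\<close>. This is possible since \<open>inv_sum U / nonzero_prod U\<close> is itself a nonzero element of the fixed field.
\<close>

lemma zero_inv_sum_mixed:
  assumes "CARD('a) = 2 ^ (7 * m)" "m \<ge> 3" "i \<le> m" "1 \<le> d" "d < m"
  shows "\<exists>V::'a set. F2_space V \<and> card V = 2 ^ (d + 3 * Suc i) \<and> inv_sum V = 0"
proof -
  have m: "m > 0" using assms(2) by simp
  obtain U where U: "F2_space U" "frob m ` U \<subseteq> U" "U \<inter> fixed_field m = {0}" "card U = 8 ^ Suc i" "inv_sum U \<noteq> 0"
    using stable_space_nonzero_inv_sum[OF assms(1-3)] by (elim exE conjE) (rule that)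
  let ?s = "inv_sum U * inverse (nonzero_prod U)"
  have s: "?s \<in> fixed_field m" "?s \<noteq> 0"
    using frob_inv_sum[OF U(2)] frob_nonzero_prod[OF U(2)] U(5) nonzero_prod_nonzero[of U]
    by (simp_all add: fixed_field_def frob_mult frob_inverse)
  have "2 ^ Suc (Suc (d - 1)) \<le> (2::nat) ^ m"
    using assms(4,5) by (intro power_increasing) auto
  also have "\<dots> \<le> card (fixed_field m)" using card_fixed_field_ge[OF assms(1) _ m] by simp
  finally have "2 ^ Suc (Suc (d - 1)) \<le> card (fixed_field m)" .
  from fixed_field_space_inv_sum[OF this s] obtain T where
    T: "T \<subseteq> fixed_field m" "F2_space T" "card T = 2 ^ d" "inv_sum T = ?s"
    using assms(4) by auto
  have "vanishing U ` fixed_field m = fixed_field m"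
    by (intro vanishing_onto U(1,3) F2_space_fixed vanishing_fixed[OF U(2)])
  then have "T \<subseteq> range (vanishing U)" using T(1) by blast
  note ext = preimage_inv_sum[OF U(1) F2_space_UNIV T(2) subset_UNIV this]
  have "8 ^ Suc i = (2::nat) ^ (3 * Suc i)" by (simp only: power_mult) simp
  then have "card U * card T = 2 ^ (d + 3 * Suc i)"
    unfolding U(4) T(3) by (simp only: power_add mult.commute)
  moreover have "inv_sum U + nonzero_prod U * inv_sum T = 0"
  proof -
    have "nonzero_prod U * inv_sum T = inv_sum U"
      using nonzero_prod_nonzero[of U] by (simp add: T(4))
    then show ?thesis by (simp add: add_self)
  qed
  ultimately show ?thesis
    using ext by (intro exI[of _ "{x \<in> UNIV. vanishing U x \<in> T}"]) simp
qed

text \<open>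
  As 7 divides the degree, the roots of \<open>x^8 + x^4 + x\<close> lie in the field; they form the line through any nonzero root \<open>x\<close>. Its inverse sum is, up to a nonzero
  factor, the coefficient of \<open>x^2\<close> in its vanishing polynomial, which is zero here. The proof checks
  the equivalent statement that the numerator \<open>span3_numerator x (x^2) (x^4)\<close> is a multiple of \<open>x^8 + x^4 + x\<close>.
\<close>

lemma zero_inv_sum_3:
  assumes "CARD('a) = 2 ^ (7 * m)" "m > 0"
  shows "\<exists>V::'a set. F2_space V \<and> card V = 2 ^ 3 \<and> inv_sum V = 0"
proof -
  have CARD: "CARD('a) = 2 ^ (m * 7)" using assms(1) by (simp add: mult.commute)
  have ge: "2 ^ 7 \<le> card (fixed_field 7)" using card_fixed_field_ge[OF CARD assms(2)] by simp
  let ?h = "\<lambda>x::'a. \<Sum>j\<in>{0, 2, 3, 4}. frob j x"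
  \<comment> \<open>The cofactor of \<open>X^3 + X^2 + 1\<close> in \<open>X^7 + 1\<close>, of degree 16 as a map, cannot annihilate a field of 128 elements.\<close>
  have "card {x. ?h x = 0} \<le> 2 ^ 4" by (rule card_roots_frob_sum) auto
  then have "card (fixed_field 7) > card {x. ?h x = 0}"
    by (rule le_less_trans[OF _ less_le_trans[OF _ ge]]) simp
  then have "\<not> fixed_field 7 \<subseteq> {x. ?h x = 0}"
    using card_mono[OF finite, of "fixed_field 7" "{x. ?h x = 0}"] by linarith
  then obtain y where y: "frob 7 y = y" "?h y \<noteq> 0" by (auto simp: fixed_field_def)
  define x where "x = ?h y"
  have eq: "x = y + (frob 2 y + (frob 3 y + frob 4 y))" by (simp add: x_def)
  have x: "x \<in> ker_320 1" "x \<noteq> 0"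
  proof -
    have "frob 3 x + frob 2 x + x = 0"
      unfolding eq by (simp add: frob_add frob_frob y(1) two_eq_0)
    then show "x \<in> ker_320 1" "x \<noteq> 0" using y(2) by (simp_all add: ker_320_def x_def)
  qed
  have f: "frob 1 x = x ^ 2" "frob 2 x = x ^ 4" "frob 3 x = x ^ 8"
    by (simp_all add: frob_def)
  have r: "x ^ 8 = x ^ 4 + x"
    using x(1) by (simp add: ker_320_def f add.assoc add_eq_0)
  have "span3_numerator x (x^2) (x^4) = (x^4 * x^4 + (x^4 + x)) * (x^3 * x^4 * (x * x^4 + x^4 + x^3 + 1))"
    unfolding span3_numerator_def
    by (simp only: power2_eq_square power3_eq_cube power4_eq_xxxx) (simp only: ring_char2 mult_1_right mult_1_left)
  also have "x^4 * x^4 + (x^4 + x) = 0"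
    using r by (simp add: add_self flip: power_add)
  finally have "span3_numerator x (frob 1 x) (frob (2 * 1) x) = 0"
    by (simp only: f mult_1_right mult_zero_left)
  then show ?thesis using line_ker_320[OF x] by (intro exI[of _ "line 1 x"]) simp
qed

section \<open>Realising every dimension\<close>

lemma inv_sum_card_2:
  assumes "F2_space (V::'a set)" "card V = 2"
  shows "inv_sum V \<noteq> 0"
proof -
  obtain a where "V = {0, a}" "a \<noteq> 0"
    using assms(2) F2_spaceD(1)[OF assms(1)] unfolding card_2_iff by auto
  then show ?thesis by (simp add: inv_sum_def)
qed

text \<open>
  For a plane spanned by \<open>a\<close> and \<open>b\<close> the numerator is \<open>a^2 + a * b + b^2\<close>, so if it vanished the cubes of \<open>a\<close> and
  \<open>b\<close> would agree. Since \<open>2 ^ n\<close> is 2 modulo 3 for odd \<open>n\<close>, cubing is injective.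
\<close>

lemma inv_sum_card_4:
  assumes "CARD('a) = 2 ^ n" "odd n" "F2_space (V::'a set)" "card V = 4"
  shows "inv_sum V \<noteq> 0"
proof
  assume zero: "inv_sum V = 0"
  have "\<not> V \<subseteq> {0}" using card_mono[of "{0}" V] assms(4) by auto
  then obtain a where a: "a \<in> V" "a \<noteq> 0" by auto
  have "card {0, a} \<le> 2" by (simp add: card_insert_le_m1)
  then have "\<not> V \<subseteq> {0, a}" using card_mono[of "{0, a}" V] assms(4) by auto
  then obtain b where b: "b \<in> V" "b \<notin> {0, a}" by auto
  note span2 = span2[OF a(2) b(2)]
  have "{0, a, b, a + b} \<subseteq> V"
    using a b F2_spaceD[OF assms(3)] by auto
  then have "V = {0, a, b, a + b}"
    using span2(2) assms(4) by (metis card_subset_eq finite)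
  moreover have "b + a \<noteq> 0" using b by (auto simp: add_eq_0)
  ultimately have "a^2 + a*b + b^2 = 0"
    using zero span2(5) a(2) b(2) by simp
  then have "(a + b) * (a^2 + a*b + b^2) = 0" by simp
  also have "(a + b) * (a^2 + a*b + b^2) = a^3 + b^3"
    by (simp only: power2_eq_square power3_eq_cube) (simp only: ring_char2)
  finally have cube: "a ^ 3 = b ^ 3" by (simp add: add_eq_0)
  obtain r where "n = 2 * r + 1" using assms(2) by (elim oddE)
  then have "2 ^ n mod 3 = (2 * 4 ^ r mod 3 :: nat)" by (simp add: power_mult)
  also have "\<dots> = 2 * (4 mod 3) ^ r mod 3" by (metis mod_mult_right_eq power_mod)
  finally have "2 ^ n mod 3 = (2 :: nat)" by simp
  then obtain q where q: "2 ^ n = 3 * q + (2 :: nat)" by (metis mult_div_mod_eq)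
  have "a ^ (3 * q + 2) = a" "b ^ (3 * q + 2) = b"
    using finite_field_power_card_eq_same[of a] finite_field_power_card_eq_same[of b]
    unfolding assms(1) q by auto
  then have "(a ^ 3) ^ q * a ^ 2 = a" "(b ^ 3) ^ q * b ^ 2 = b"
    by (simp_all only: power_add power_mult)
  then have "(a ^ 3) ^ q * a = 1" "(b ^ 3) ^ q * b = 1"
    using a(2) b(2) by (simp_all add: power2_eq_square)
  then have "(b ^ 3) ^ q * a = (b ^ 3) ^ q * b" using cube by simp
  then show False using b(2) by simp
qed

lemma zero_inv_sum_dual:
  assumes "CARD('a) = 2 ^ n" "n \<ge> 2" "k \<le> n" "F2_space (V::'a set)" "card V = 2 ^ k" "inv_sum V = 0"
  shows "\<exists>W::'a set. F2_space W \<and> card W = 2 ^ (n - k) \<and> inv_sum W = 0"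
proof -
  have "2 ^ 2 \<le> (2 ^ n :: nat)" using assms(2) by (intro power_increasing) auto
  then have "CARD('a) > 2" using assms(1) by simp
  from inv_sum_dual[OF assms(4) this] obtain W :: "'a set" where
    W: "F2_space W" "card V * card W = CARD('a)" "inv_sum V + nonzero_prod V * inv_sum W = 0"
    by (elim exE conjE) (rule that)
  have "2 ^ n = 2 ^ k * (2 ^ (n - k) :: nat)" using assms(3) by (simp flip: power_add)
  then have "card W = 2 ^ (n - k)" using W(2) assms(1,5) by simp
  moreover have "inv_sum W = 0" using W(3) assms(6) nonzero_prod_nonzero[of V] by simp
  ultimately show ?thesis using W(1) by (intro exI[of _ W]) simp
qed

text \<open>
  Both spaces are closed under multiplication by the subfield with 8 elements: the kernel
  \<open>ker_320 3\<close> in dimension 9, and in dimension 6 the preimage under \<open>x \<mapsto> x^8 + x\<close> of a line over that subfield.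
\<close>

lemma zero_inv_sum_degree_21:
  assumes "CARD('a) = 2 ^ 21" "k = 6 \<or> k = 9"
  shows "\<exists>V::'a set. F2_space V \<and> card V = 2 ^ k \<and> inv_sum V = 0"
proof -
  have C1: "CARD('a) = 2 ^ (7 * 3)" using assms(1) by simp
  have cf: "card (fixed_field 3) = 8"
    using card_fixed_field_ge[OF C1] card_fixed_field_le[of 3] by simp
  then obtain c where c: "c \<in> fixed_field 3" "c \<noteq> 0" "c \<noteq> 1"
    using fixed_field_nontrivial[of 3] by auto
  from assms(2) show ?thesis
  proof
    assume k: "k = 9"
    have "card (ker_320 3) = 2 ^ k"
      using card_ker_320_ge[OF C1] card_ker_320_le[of 3] k by simp
    moreover have "inv_sum (ker_320 3) = 0"
      by (rule inv_sum_eq_0_of_closed[OF fixed_mult_ker_320[OF c(1)] c(2,3)])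
    ultimately show ?thesis using F2_space_ker_320 by (intro exI[of _ "ker_320 3"]) simp
  next
    assume k: "k = 6"
    \<comment> \<open>The kernel of this map is the subfield with 8 elements, and the map is linear over that subfield.\<close>
    let ?h = "\<lambda>x::'a. frob 3 x + x"
    have add: "?h (x + y) = ?h x + ?h y" for x y by (simp add: frob_add ac_simps)
    have ker: "{x \<in> UNIV. ?h x = 0} = fixed_field 3" by (simp add: fixed_field_def add_eq_0)
    have "\<not> UNIV \<subseteq> fixed_field 3"
      using card_mono[of "fixed_field 3" UNIV] cf assms(1) by auto
    then obtain y where y: "?h y \<noteq> 0" using ker by auto
    let ?t = "?h y"
    let ?T = "(*) ?t ` fixed_field 3"
    have h_mult: "?h (d * x) = d * ?h x" if "d \<in> fixed_field 3" for d x
      using that by (simp add: frob_mult fixed_field_def distrib_left)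
    have T: "F2_space ?T" "card ?T = 8"
      using F2_space_scale[OF F2_space_fixed] card_scale[OF y] cf by simp_all
    have sub: "?T \<subseteq> range ?h"
    proof
      fix z assume "z \<in> ?T"
      then obtain d where "d \<in> fixed_field 3" "z = ?t * d" by blast
      then have "z = ?h (d * y)" using h_mult by (simp add: mult.commute)
      then show "z \<in> range ?h" by blast
    qed
    let ?V = "{x \<in> UNIV. ?h x \<in> ?T}"
    note pre = preimage_F2_space[OF F2_space_UNIV add T(1) sub, unfolded ker cf T(2)]
    have "c * x \<in> ?V" if "x \<in> ?V" for x
    proof -
      obtain d where d: "d \<in> fixed_field 3" "?h x = ?t * d" using \<open>x \<in> ?V\<close> by blast
      then have "?h (c * x) = ?t * (c * d)" unfolding h_mult[OF c(1)] by (simp add: mult.left_commute)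
      then show ?thesis using fixed_mult[OF c(1) d(1)] by blast
    qed
    then have "inv_sum ?V = 0" by (rule inv_sum_eq_0_of_closed[OF _ c(2,3)])
    then show ?thesis using pre(1,3) k by (intro exI[of _ ?V]) simp
  qed
qed

text \<open>
  For \<open>m \<ge> 5\<close> and \<open>k \<ge> 4\<close>, the number \<open>k\<close> is written as \<open>d + 3 * j\<close> with \<open>j\<close> as large as possible subject to \<open>d \<ge> 1\<close>
  and \<open>j \<le> m + 1\<close>. Then \<open>d \<le> 3 < m\<close> unless \<open>j\<close> reaches its bound, and in that case \<open>2 * k < 7 * m\<close> keeps \<open>d\<close> below \<open>m\<close>. For
  \<open>m = 3\<close> only \<open>d = 1\<close> and \<open>d = 2\<close> are available, so multiples of 3 are treated separately.
\<close>

lemma zero_inv_sum_lower_half: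
  assumes "CARD('a) = 2 ^ (7 * m)" "odd m" "3 \<le> k" "2 * k < 7 * m"
  shows "\<exists>V::'a set. F2_space V \<and> card V = 2 ^ k \<and> inv_sum V = 0"
proof (cases "k = 3")
  case True
  have "m > 0" using assms(2) by (cases m) auto
  then show ?thesis using zero_inv_sum_3[OF assms(1)] True by simp
next
  case False
  have m: "m = 3 \<or> m \<ge> 5"
  proof -
    have "m \<noteq> 1" "m \<noteq> 0" using assms False by auto
    then show ?thesis using assms(2) by presburger
  qed
  have mixed: ?thesis if "d + 3 * Suc i = k" "i \<le> m" "1 \<le> d" "d < m" for d i
    using zero_inv_sum_mixed[OF assms(1) _ that(2-4)] that(1) m by auto
  show ?thesis
  proof (cases "m = 3")
    case True
    show ?thesis
    proof (cases "3 dvd k")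
      case dvd: True
      then have "k = 6 \<or> k = 9" using assms(3,4) \<open>m = 3\<close> False by presburger
      then show ?thesis using zero_inv_sum_degree_21 assms(1) \<open>m = 3\<close> by simp
    next
      case ndvd: False
      then show ?thesis
        using assms(3,4) \<open>m = 3\<close> by (intro mixed[of "k mod 3" "k div 3 - 1"]) presburger+
    qed
  next
    case m3: False
    define j where "j = min ((k - 1) div 3) (m + 1)"
    have "1 \<le> k - 3 * j" "k - 3 * j < m" "k - 3 * j + 3 * Suc (j - 1) = k" "j - 1 \<le> m"
      using assms(3,4) m m3 False unfolding j_def min_def by (auto split: if_splits; linarith)+
    then show ?thesis using mixed by blast
  qed
qed

lemma zero_inv_sum_exists:
  assumes "CARD('a) = 2 ^ n" "odd n" "7 dvd n" "3 \<le> k" "k \<le> n - 3"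
  shows "\<exists>V::'a set. F2_space V \<and> card V = 2 ^ k \<and> inv_sum V = 0"
proof -
  obtain m where m: "n = 7 * m" using assms(3) by (elim dvdE)
  have C: "CARD('a) = 2 ^ (7 * m)" "odd m" using assms(1,2) m by simp_all
  show ?thesis
  proof (cases "2 * k < n")
    case True
    then show ?thesis using zero_inv_sum_lower_half[OF C assms(4)] m by simp
  next
    case False
    moreover have "2 * k \<noteq> n" using assms(2) by auto
    ultimately have nk: "2 * (n - k) < 7 * m" "3 \<le> n - k" "n - k \<le> n" "n \<ge> 2" "n - (n - k) = k"
      using assms(4,5) m by auto
    obtain V :: "'a set" where "F2_space V" "card V = 2 ^ (n - k)" "inv_sum V = 0"
      using zero_inv_sum_lower_half[OF C nk(2,1)] by (elim exE conjE) (rule that)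
    from zero_inv_sum_dual[OF assms(1) nk(4,3) this] show ?thesis unfolding nk(5) .
  qed
qed

lemma inv_sum_nonzero:
  assumes "CARD('a) = 2 ^ n" "odd n" "n \<ge> 3" "k \<in> {1, 2, n - 2, n - 1}" "F2_space (V::'a set)" "card V = 2 ^ k"
  shows "inv_sum V \<noteq> 0"
proof -
  have small: "inv_sum W \<noteq> 0" if "j \<in> {1, 2}" "F2_space W" "card W = 2 ^ j" for j and W :: "'a set"
  proof (cases "j = 1")
    case True
    then show ?thesis using inv_sum_card_2[OF that(2)] that(3) by simp
  next
    case False
    then show ?thesis using inv_sum_card_4[OF assms(1,2) that(2)] that(1,3) by simp
  qed
  show ?thesis
  proof (cases "k \<in> {1, 2}")
    case True
    then show ?thesis using small[OF True assms(5,6)] by simp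
  next
    case False
    then have k: "k \<le> n" "n - k \<in> {1, 2}" "n \<ge> 2" using assms(3,4) by auto
    show ?thesis
    proof
      assume "inv_sum V = 0"
      from zero_inv_sum_dual[OF assms(1) k(3,1) assms(5,6) this] obtain W :: "'a set" where
        "F2_space W" "card W = 2 ^ (n - k)" "inv_sum W = 0"
        by (elim exE conjE) (rule that)
      then show False using small[OF k(2)] by simp
    qed
  qed
qed

lemma subspace_F2_scale_iff: "module.subspace F2_scale (V::'a set) \<longleftrightarrow> F2_space V"
proof -
  interpret vs: vector_space "F2_scale :: bit \<Rightarrow> 'a \<Rightarrow> 'a" by (rule vector_space_F2_scale[OF char_two])
  have "F2_scale c x \<in> V" if "0 \<in> V" "x \<in> V" for c and x :: 'a
    using that by (cases c) (simp_all add: F2_scale_def)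
  then show ?thesis by (auto simp: vs.subspace_def F2_space_def)
qed

text \<open>
  Adjoining a vector to an independent family doubles its span.
\<close>

lemma card_eq_2_power_dim:
  assumes "F2_space (V::'a set)"
  shows "card V = 2 ^ vector_space.dim F2_scale V"
proof -
  interpret vs: vector_space "F2_scale :: bit \<Rightarrow> 'a \<Rightarrow> 'a" by (rule vector_space_F2_scale[OF char_two])
  have card_span: "card (vs.span B) = 2 ^ card B" if "vs.independent B" for B
    using finite[of B] that
  proof (induction B)
    case (insert b B)
    have b: "b \<notin> vs.span B" and B: "vs.independent B"
      using insert.prems insert.hyps(2) by (simp_all add: vs.independent_insert)
    have sp: "F2_space (vs.span B)" using subspace_F2_scale_iff vs.subspace_span by blast
    have scale: "(\<exists>c. P (F2_scale c b)) \<longleftrightarrow> P 0 \<or> P b" for P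
    proof -
      have "(\<exists>c. P (F2_scale c b)) \<longleftrightarrow> P (F2_scale 0 b) \<or> P (F2_scale 1 b)"
        by (metis bit.exhaust)
      then show ?thesis by (simp add: F2_scale_def)
    qed
    have "vs.span (insert b B) = {x. x \<in> vs.span B \<or> b + x \<in> vs.span B}"
      unfolding vs.span_insert scale[of "\<lambda>y. _ - y \<in> vs.span B"] by (simp add: diff_eq add.commute)
    also have "\<dots> = vs.span B \<union> (+) b ` vs.span B"
    proof (intro equalityI subsetI)
      fix x assume "x \<in> {x. x \<in> vs.span B \<or> b + x \<in> vs.span B}"
      moreover have "x = b + (b + x)" by (simp only: add_self_left)
      ultimately show "x \<in> vs.span B \<union> (+) b ` vs.span B" by blast
    qed (auto simp: add_self_left)
    finally have "card (vs.span (insert b B)) = card (vs.span B) + card ((+) b ` vs.span B)"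
      using coset_disjoint[OF sp b] by (simp add: card_Un_disjoint)
    then show ?case using insert.IH[OF B] insert.hyps by (simp add: card_image)
  qed simp
  obtain B where B: "B \<subseteq> V" "vs.independent B" "V \<subseteq> vs.span B" "card B = vs.dim V"
    by (rule vs.basis_exists)
  have "vs.span B \<subseteq> V" using B(1) assms by (intro vs.span_minimal) (simp_all add: subspace_F2_scale_iff)
  then have "vs.span B = V" using B(3) by (intro equalityI)
  then show ?thesis using card_span[OF B(2)] B(4) by simp
qed

text \<open>
  Affine subspaces that avoid \<open>0\<close> never have sum zero by the coset formula, which leaves the linear ones.
\<close>

lemma sum_free_f_inv_iff:
  "sum_free k (f_inv :: 'a \<Rightarrow> 'a) \<longleftrightarrow> (\<forall>V::'a set. F2_space V \<and> card V = 2 ^ k \<longrightarrow> inv_sum V \<noteq> 0)"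
proof -
  have f: "f_inv = (inverse :: 'a \<Rightarrow> 'a)" by (auto simp: f_inv_def)
  have dim: "vector_space.dim F2_scale V = k \<longleftrightarrow> card V = 2 ^ k" if "F2_space V" for V :: "'a set"
    using card_eq_2_power_dim[OF that] by simp
  have sum: "(\<Sum>x\<in>(+) a ` V. inverse x) = (if a \<in> V then inv_sum V else nonzero_prod V / vanishing V a)"
    if "F2_space V" for a and V :: "'a set"
  proof (cases "a \<in> V")
    case True
    have "(+) a ` V = V"
      using True F2_spaceD(2)[OF that] by (intro endo_inj_surj) auto
    then show ?thesis using True by (simp add: inv_sum_def)
  next
    case False
    then show ?thesis using coset_inv_sum[OF that False] by (simp add: sum.reindex)
  qed
  have nz: "nonzero_prod V / vanishing V a \<noteq> 0" if "a \<notin> V" for a and V :: "'a set"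
    using that nonzero_prod_nonzero[of V] by (simp add: vanishing_eq_0_iff)
  show ?thesis
  proof (intro iffI allI impI)
    fix V :: "'a set"
    assume sf: "sum_free k (f_inv :: 'a \<Rightarrow> 'a)" and V: "F2_space V \<and> card V = 2 ^ k"
    have "F2_affine_subspace k ((+) 0 ` V)"
      unfolding F2_affine_subspace_def using V dim subspace_F2_scale_iff by blast
    then have "(\<Sum>x\<in>(+) 0 ` V. inverse x) \<noteq> 0"
      using sf unfolding sum_free_def f by blast
    then show "inv_sum V \<noteq> 0" using V sum[of V 0] F2_spaceD(1)[of V] by simp
  next
    assume *: "\<forall>V::'a set. F2_space V \<and> card V = 2 ^ k \<longrightarrow> inv_sum V \<noteq> 0"
    show "sum_free k (f_inv :: 'a \<Rightarrow> 'a)"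
      unfolding sum_free_def f
    proof (intro allI impI)
      fix A :: "'a set"
      assume "F2_affine_subspace k A"
      then obtain a V where V: "F2_space V" "card V = 2 ^ k" "A = (+) a ` V"
        unfolding F2_affine_subspace_def subspace_F2_scale_iff using dim by blast
      then show "(\<Sum>x\<in>A. inverse x) \<noteq> 0"
        using * sum[OF V(1), of a] nz[of a V] by simp
    qed
  qed
qed

end

theorem theorem5p7:
  fixes n k :: nat
  assumes "n \<ge> 3" and "odd n" and "7 dvd n"
    and "1 \<le> k" and "k \<le> n - 1"
    and "(n, k) \<noteq> (49, 23)" and "(n, k) \<noteq> (49, 26)"
    and "CARD('a::finite_field) = 2 ^ n"
  shows "sum_free k (f_inv :: 'a \<Rightarrow> 'a) \<longleftrightarrow> k \<in> {1, 2, n - 2, n - 1}"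
proof -
  interpret binary_field "TYPE('a)"
    by unfold_locales (rule CHAR_eq_2_of_CARD[OF assms(8)])
  show ?thesis
  proof (cases "k \<in> {1, 2, n - 2, n - 1}")
    case True
    then show ?thesis
      using inv_sum_nonzero[OF assms(8,2,1) True] by (simp only: sum_free_f_inv_iff) blast
  next
    case False
    then have "3 \<le> k" "k \<le> n - 3" using assms(4,5) by auto
    from zero_inv_sum_exists[OF assms(8,2,3) this] show ?thesis
      using False by (simp only: sum_free_f_inv_iff) blast
  qed
qed

end
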